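(* Let $X$ be a real random variable with $\mathbb{E}|X|<\infty$ and CDF $F_X$, let $\alpha\in(0,1]$, $\delta\in(0,1)$, let $n\ge1$ be an integer and $\epsilon=\sqrt{\ln(1/\delta)/(2n)}$. Let $X_1,\dots,X_n$ be i.i.d. with CDF $F_X$, with empirical cumulative distribution function $\hat F_X$. (1) Upper bound. Suppose $P(X\le b)=1$ for some $b\in\mathbb{R}$. Then: (a) if $\alpha>\epsilon$, then $$P\Bigl(\mathrm{CVaR}_\alpha(X)\le\bigl(1-\tfrac{\epsilon}{\alpha}\bigr)C^{\hat F_X}_{\alpha-\epsilon}+\tfrac{\epsilon}{\alpha}b\Bigr)>1-\delta;$$ (b) if $\alpha\le\epsilon$, then $\mathrm{CVaR}_\alpha(X)\le b$. (2) Lower bound. Suppose $P(X\ge a)=1$ for some $a\in\mathbb{R}$. Then: (a) if $\alpha+\epsilon<1$, then $$P\Bigl(\mathrm{CVaR}_\alpha(X)\ge\bigl(1+\tfrac{\epsilon}{\alpha}\bigr)C^{\hat F_X}_{\alpha+\epsilon}-\tfrac{\epsilon}{\alpha}C^{\hat F_X}_{\epsilon}\Bigr)>1-\delta;$$ (b) if $\alpha+\epsilon\ge1$ (and $\epsilon\le1$, so that $C^{\hat F_X}_\epsilon$ is defined), then $$P\Bigl(\mathrm{CVaR}_\alpha(X)\ge\tfrac{1}{\alpha}\bigl[(\alpha+\epsilon-1)a+E_{\hat F_X}[X]-\epsilon\,C^{\hat F_X}_\epsilon\bigr]\Bigr)>1-\delta.$$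
   Context: For a random variable $Z$ and a level $\alpha\in(0,1]$, $\mathrm{CVaR}_\alpha(Z)=\inf_{w\in\mathbb{R}}\{w+\frac{1}{\alpha}\mathbb{E}[(Z-w)^+]\}$, where $(x)^+=\max(x,0)$; $\mathrm{CVaR}_1(Z)=\mathbb{E}[Z]$ for integrable $Z$. The empirical CDF is $\hat F_X(x)=\frac1n\sum_{i=1}^n 1_{X_i\le x}$. $E_{\hat F_X}[X]=\frac1n\sum_{i=1}^nX_i$ is the expectation under $\hat F_X$, and $C^{\hat F_X}_\beta=\inf_{w\in\mathbb{R}}\{w+\frac{1}{n\beta}\sum_{i=1}^n(X_i-w)^+\}$, $\beta\in(0,1]$, is the CVaR at level $\beta$ of the distribution $\hat F_X$. The probabilities $P$ are over the sample $X_1,\dots,X_n$. *)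

theory Defs
  imports "HOL-Probability.Probability"
begin

text \<open>
  Both infima below are taken in the conditionally complete lattice of the reals, so they are
  meaningful only when the function of \<open>w\<close> is bounded below. For an integrable \<open>Z\<close> (respectively
  for a nonempty finite sample) this is the case for every level in \<open>(0, 1]\<close>; for levels outside
  this range the values are junk and must not be used.
\<close>

definition cvar :: "'a measure \<Rightarrow> real \<Rightarrow> ('a \<Rightarrow> real) \<Rightarrow> real" where
  "cvar M \<alpha> Z = (INF w. w + 1 / \<alpha> * (\<integral>\<omega>. max (Z \<omega> - w) 0 \<partial>M))"

text \<open>
  A sample of size \<open>n\<close> is a function \<open>x\<close> of which only the values \<open>x 1, \<dots>, x n\<close> matter.
\<close>

definition emp_cdf :: "nat \<Rightarrow> (nat \<Rightarrow> real) \<Rightarrow> real \<Rightarrow> real" where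
  "emp_cdf n x t = 1 / real n * (\<Sum>i = 1..n. indicator {..t} (x i))"

definition emp_mean :: "nat \<Rightarrow> (nat \<Rightarrow> real) \<Rightarrow> real" where
  "emp_mean n x = 1 / real n * (\<Sum>i = 1..n. x i)"

definition emp_cvar :: "nat \<Rightarrow> (nat \<Rightarrow> real) \<Rightarrow> real \<Rightarrow> real" where
  "emp_cvar n x \<beta> = (INF w. w + 1 / (real n * \<beta>) * (\<Sum>i = 1..n. max (x i - w) 0))"

text \<open>
  The empirical quantities are the CDF, the mean and the CVaR of one and the same
  distribution, the uniform distribution on the sample points.
\<close>

definition emp_distr :: "nat \<Rightarrow> (nat \<Rightarrow> real) \<Rightarrow> real pmf" where
  "emp_distr n x = map_pmf x (pmf_of_set {1..n})"

lemma expectation_emp_distr: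
  fixes f :: "real \<Rightarrow> real"
  assumes "1 \<le> n"
  shows "measure_pmf.expectation (emp_distr n x) f = 1 / real n * (\<Sum>i = 1..n. f (x i))"
  using assms by (simp add: emp_distr_def integral_pmf_of_set)

lemma cdf_emp_distr:
  assumes "1 \<le> n"
  shows "cdf (measure_pmf (emp_distr n x)) t = emp_cdf n x t"
  using expectation_emp_distr[OF assms, of x "indicator {..t}"]
  by (simp add: cdf_def emp_cdf_def)

lemma mean_emp_distr:
  assumes "1 \<le> n"
  shows "measure_pmf.expectation (emp_distr n x) (\<lambda>t. t) = emp_mean n x"
  using expectation_emp_distr[OF assms] by (simp add: emp_mean_def)

lemma cvar_emp_distr:
  assumes "1 \<le> n"
  shows "cvar (measure_pmf (emp_distr n x)) \<beta> (\<lambda>t. t) = emp_cvar n x \<beta>"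
  using expectation_emp_distr[OF assms] by (simp add: cvar_def emp_cvar_def mult.commute)

end

theory Submission
  imports Defs
begin

text \<open>
  Write \<open>E (X - w)^+\<close> as the integral of the tail probabilities over \<open>(w, \<infinity>)\<close>. If the empirical
  CDF exceeds the true one by at most \<open>\<epsilon>\<close> everywhere, then this representation, used separately
  for every \<open>w\<close>, turns the infimum defining the empirical CVaR at level \<open>\<alpha> - \<epsilon>\<close> into an upper
  bound; the opposite inequality between the two CDFs gives the lower bounds, by playing the
  minimisation variables of the three infima against each other. Both parts thus reduce to the
  one-sided Dvoretzky-Kiefer-Wolfowitz inequality with Massart's constant, applied to \<open>X\<close> and \<open>-X\<close>.

  For that inequality let \<open>K t\<close> be the number of samples at most \<open>t\<close>. For \<open>c > 0\<close> the process
  \<open>(1 + c / F t)^(K t)\<close> is a reverse martingale of mean \<open>(1 + c)^n\<close>, and when \<open>K t > n (F t + \<epsilon>)\<close> it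
  exceeds \<open>exp (n (F t + \<epsilon>) ln (1 + c / F t))\<close>. A suitable \<open>c\<close>, roughly \<open>2 \<epsilon>\<close>, makes
  \<open>(s + \<epsilon>) ln (1 + c / s) - ln (1 + c) > 2 \<epsilon>^2\<close> simultaneously for all \<open>s\<close>, so the maximal inequality
  gives a crossing probability strictly below \<open>exp (- 2 n \<epsilon>^2) = \<delta>\<close>, for every \<open>\<delta>\<close> in \<open>(0, 1)\<close>.
\<close>

section \<open>The exponent\<close>

text \<open>
  The bound is the Taylor polynomial of order 4 at 0. The logarithm is \<open>ln (1 + c)\<close> for the
  parameter \<open>c = 6 x / (3 - 4 x)\<close>, which is the value \<open>x / (1 - t - x)\<close> that
  is optimal at the approximately critical point \<open>t = 1 / 2 - x / 3\<close>; this is why the exponent below stays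
  above \<open>2 x^2\<close> for all \<open>t\<close> at once.
\<close>

lemma ln_ratio_lower_bound:
  fixes x :: real
  assumes "0 \<le> x" "x \<le> 1 / 2"
  shows "2 * x + 2 / 3 * x^2 + 8 / 9 * x^3 + 20 / 27 * x^4 \<le> ln (3 + 2 * x) - ln (3 - 4 * x)"
proof -
  define f where "f y = ln (3 + 2 * y) - ln (3 - 4 * y)
    - (2 * y + 2 / 3 * y^2 + 8 / 9 * y^3 + 20 / 27 * y^4)" for y :: real
  have "f 0 \<le> f x"
  proof (rule DERIV_nonneg_imp_nondecreasing[OF assms(1)])
    fix y assume y: "0 \<le> y" "y \<le> x"
    define q where "q = 2 + 4 / 3 * y + 8 / 3 * y^2 + 80 / 27 * y^3"
    let ?d = "2 / (3 + 2 * y) + 4 / (3 - 4 * y) - q"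
    have pos: "0 < 3 + 2 * y" "0 < 3 - 4 * y" using y assms by auto
    have "(f has_real_derivative ?d) (at y)"
      unfolding f_def q_def using pos
      by (auto intro!: derivative_eq_intros simp: algebra_simps)
    moreover have "2 / D + 4 / B - q = (2 * B + 4 * D - q * (D * B)) / (D * B)"
      if "B \<noteq> 0" "D \<noteq> 0" for B D :: real
      using that by (simp add: field_simps)
    then have "?d = (2 * (3 - 4 * y) + 4 * (3 + 2 * y) - q * ((3 + 2 * y) * (3 - 4 * y))) / ((3 + 2 * y) * (3 - 4 * y))"
      using pos by (metis less_irrefl)
    \<comment> \<open>\<open>q\<close> is the Taylor polynomial of order 3 of the two fractions, so
      the numerator starts with \<open>y^4\<close>; its remaining coefficients are positive.\<close>
    moreover have num: "2 * (3 - 4 * y) + 4 * (3 + 2 * y) - q * ((3 + 2 * y) * (3 - 4 * y)) = y^4 * (1056 + 640 * y) / 27"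
      unfolding q_def by (simp add: field_simps power2_eq_square power3_eq_cube power4_eq_xxxx)
    moreover have "0 \<le> y^4 * (1056 + 640 * y) / 27" using y by simp
    ultimately have "0 \<le> ?d" using pos by (metis divide_nonneg_pos mult_pos_pos)
    with \<open>(f has_real_derivative ?d) (at y)\<close>
    show "\<exists>d. (f has_real_derivative d) (at y) \<and> 0 \<le> d" by blast
  qed
  then show ?thesis by (simp add: f_def)
qed

lemma quadratic_nonneg:
  fixes a b d t :: real
  assumes "0 < a" "b^2 \<le> 4 * a * d"
  shows "0 \<le> a * t^2 + b * t + d"
proof -
  have "4 * a * (a * t^2 + b * t + d) = (2 * a * t + b)^2 + (4 * a * d - b^2)"
    by (simp add: algebra_simps power2_eq_square)
  with assms have "0 \<le> 4 * a * (a * t^2 + b * t + d)" by simp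
  with assms show ?thesis by (simp add: zero_le_mult_iff)
qed

text \<open>
  This quadratic in \<open>t\<close> is, up to a positive factor, the derivative in the next lemma with
  the logarithm replaced by its Taylor polynomial.
\<close>

lemma dkw_discriminant:
  fixes x t :: real
  assumes "0 \<le> x" "x \<le> 1 / 2"
  shows "0 \<le> (216 - 128 * x^2) * t^2
    + (-216 + 23973/100 * x + 11427/50 * x^2 - 248/3 * x^3 + 6328/225 * x^4 + 640/27 * x^5) * t
    + (54 - 108 * x - 27/50 * x^2 + 1809/25 * x^3 - 5164/75 * x^4 - 320/9 * x^5)"
    (is "0 \<le> ?a * t^2 + ?b * t + ?d")
proof (rule quadratic_nonneg)
  have step: "x^(Suc k) \<le> x^k / 2" for k
    using assms mult_right_mono[of x "1/2" "x^k"] by simp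
  have x2: "x^2 \<le> x / 2" using step[of 1] by (simp add: power2_eq_square)
  have x3: "x^3 \<le> x / 4" and x4: "x^4 \<le> x / 8" and x8: "x^8 \<le> x / 128" and x9: "x^9 \<le> x / 256"
    using x2 step[of 2] step[of 3] step[of 4] step[of 5] step[of 6] step[of 7] step[of 8]
    by (simp_all add: eval_nat_numeral)
  have nn: "0 \<le> x^5" "0 \<le> x^6" "0 \<le> x^7" using assms by simp_all
  show "0 < ?a" using x2 assms by simp
  \<comment> \<open>The constant terms of \<open>4 * ?a * ?d\<close> and of \<open>?b^2\<close> both
    equal 216^2 and cancel, which leaves a factor \<open>x\<close>.\<close>
  let ?p = "256284/25 + 131442471/10000 * x - 68681871/2500 * x^2 - 149145529/2500 * x^3
    - 62301724/1875 * x^4 + 23619544/5625 * x^5 + 8113408/675 * x^6 + 52785472/16875 * x^7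
    - 1619968/1215 * x^8 - 409600/729 * x^9"
  have "4 * ?a * ?d - ?b^2 = x * ?p"
    by (simp add: field_simps power2_eq_square power3_eq_cube power4_eq_xxxx eval_nat_numeral)
  \<comment> \<open>Powers with a negative coefficient are bounded by multiples of \<open>x\<close>,
    the others from below by 0; the resulting linear function is still positive at
    \<open>x = 1 / 2\<close>.\<close>
  moreover have "0 \<le> ?p" using x2 x3 x4 x8 x9 nn assms by linarith
  ultimately show "?b^2 \<le> 4 * ?a * ?d" using assms by (metis diff_ge_0_iff_ge mult_nonneg_nonneg)
qed

text \<open>The expression is the derivative in \<open>x\<close> of the function \<open>h\<close> in
  the next lemma. Multiplying by \<open>(t + x)^2\<close> and by the positive denominators, and
  bounding the logarithm by its Taylor polynomial, leaves \<open>x^2\<close> times the quadratic of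
  \<open>dkw_discriminant\<close>. The term \<open>x^3 / 100\<close> is the slack that later yields
  strictness.\<close>

lemma dkw_slope_nonneg:
  fixes x t :: real
  assumes "0 \<le> x" "x \<le> 1 / 2" "0 < t" "t + x \<le> 1"
  shows "0 \<le> (6 - 4 * t) / ((3 - 4 * x) * t + 6 * x) + 4 / (3 - 4 * x)
    - (2 / (3 + 2 * x) + 4 / (3 - 4 * x) + 4 * x) / (t + x)
    + (ln (3 + 2 * x) - ln (3 - 4 * x) + 2 * x^2) / (t + x)^2 - x^3 / 100"
    (is "0 \<le> ?h")
proof -
  define B where "B = 3 - 4 * x"
  define D where "D = 3 + 2 * x"
  define E where "E = B * t + 6 * x"
  define L where "L = 2 * x + 2 / 3 * x^2 + 8 / 9 * x^3 + 20 / 27 * x^4"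
  have B: "0 < B" and D: "0 < D" using assms by (auto simp: B_def D_def)
  have E: "0 < E" using B assms by (simp add: E_def add_pos_nonneg)
  have eq1: "(6 - 4 * t) / E + 4 / B = 18 / (B * E)"
  proof -
    have "(6 - 4 * t) / E + 4 / B = ((6 - 4 * t) * B + 4 * E) / (B * E)" using B E by (simp add: field_simps)
    also have "(6 - 4 * t) * B + 4 * E = 18" by (simp add: B_def E_def algebra_simps)
    finally show ?thesis .
  qed
  have eq2: "2 / D + 4 / B = 18 / (B * D)"
  proof -
    have "2 / D + 4 / B = (2 * B + 4 * D) / (B * D)" using B D by (simp add: field_simps)
    also have "2 * B + 4 * D = 18" by (simp add: B_def D_def algebra_simps)
    finally show ?thesis .
  qed
  let ?S = "L + 2 * x^2 - x^3 / 100"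
  have "18 * D * (t + x)^2 - (t + x) * (18 + 4 * x * (B * D)) * E + ?S * (B * D * E)
    = x^2 * ((216 - 128 * x^2) * t^2
    + (-216 + 23973/100 * x + 11427/50 * x^2 - 248/3 * x^3 + 6328/225 * x^4 + 640/27 * x^5) * t
    + (54 - 108 * x - 27/50 * x^2 + 1809/25 * x^3 - 5164/75 * x^4 - 320/9 * x^5))"
    unfolding B_def D_def E_def L_def
    by (simp add: field_simps power2_eq_square power3_eq_cube power4_eq_xxxx eval_nat_numeral)
  then have num: "0 \<le> 18 * D * (t + x)^2 - (t + x) * (18 + 4 * x * (B * D)) * E + ?S * (B * D * E)"
    using dkw_discriminant[OF assms(1,2), of t] by simp
  have "0 \<le> (18 * D * (t + x)^2 - (t + x) * (18 + 4 * x * (B * D)) * E + ?S * (B * D * E)) / (B * D * E)"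
    using num B D E by simp
  also have "\<dots> = 18 / (B * E) * (t + x)^2 - (t + x) * (18 / (B * D) + 4 * x) + ?S"
    using B D E by (simp add: field_simps)
  also have "\<dots> \<le> 18 / (B * E) * (t + x)^2 - (t + x) * (18 / (B * D) + 4 * x)
      + (ln D - ln B + 2 * x^2) - (t + x)^2 * (x^3 / 100)"
  proof -
    \<comment> \<open>Since \<open>t + x \<le> 1\<close>, the slack survives multiplication by
      \<open>(t + x)^2\<close>.\<close>
    have "(t + x)^2 * (x^3 / 100) \<le> 1 * (x^3 / 100)"
      using assms by (intro mult_right_mono power_le_one) auto
    then show ?thesis using ln_ratio_lower_bound[OF assms(1,2)] unfolding L_def B_def D_def by linarith
  qed
  also have "\<dots> = (t + x)^2 * (18 / (B * E) - (18 / (B * D) + 4 * x) / (t + x)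
      + (ln D - ln B + 2 * x^2) / (t + x)^2 - x^3 / 100)"
  proof -
    have "s^2 * (p - q / s + r / s^2 - y) = p * s^2 - s * q + r - s^2 * y" if "s \<noteq> 0" for p q r s y :: real
      using that by (simp add: field_simps power2_eq_square)
    from this[of "t + x"] show ?thesis using assms by simp
  qed
  also have "\<dots> = (t + x)^2 * ?h"
    unfolding eq1[symmetric] eq2[symmetric] by (simp add: B_def D_def E_def)
  finally show ?thesis using assms by (simp add: zero_le_mult_iff)
qed


text \<open>Divide by \<open>t + x\<close>, fix \<open>t\<close> and let \<open>x\<close> grow from
  0, with the parameter \<open>c = 6 * x / (3 - 4 * x)\<close> moving along. The difference vanishes
  at 0 and is nondecreasing. After the division the logarithm that involves \<open>t\<close> stands
  alone and has a rational derivative.\<close>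

lemma dkw_exponent_small:
  fixes x t :: real
  assumes "0 \<le> x" "x \<le> 1 / 2" "0 < t" "t + x \<le> 1"
  shows "ln (1 + 6 * x / (3 - 4 * x)) + 2 * x^2 + x^5 / 400
    \<le> (t + x) * ln (1 + 6 * x / (3 - 4 * x) / t)"
proof -
  define h where "h y = ln ((3 - 4 * y) * t + 6 * y) - ln t - ln (3 - 4 * y)
    - (ln (3 + 2 * y) - ln (3 - 4 * y) + 2 * y^2) / (t + y) - y^4 / 400" for y
  have "h 0 \<le> h x"
  proof (rule DERIV_nonneg_imp_nondecreasing[OF assms(1)])
    fix y assume y: "0 \<le> y" "y \<le> x"
    have pos: "0 < 3 + 2 * y" "0 < 3 - 4 * y" "0 < t + y" using y assms by auto
    have E: "0 < (3 - 4 * y) * t + 6 * y" using y pos assms by (simp add: add_pos_nonneg)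
    let ?u = "\<lambda>y. ln (3 + 2 * y) - ln (3 - 4 * y) + 2 * y^2"
    let ?u' = "2 / (3 + 2 * y) + 4 / (3 - 4 * y) + 4 * y"
    have "(?u has_real_derivative ?u') (at y)"
      using pos by (auto intro!: derivative_eq_intros simp: algebra_simps)
    from DERIV_quotient[OF this, of "\<lambda>y. t + y" 1]
    have u: "((\<lambda>y. ?u y / (t + y)) has_real_derivative (?u' * (t + y) - ?u y) / (t + y)^2) (at y)"
      using pos by (auto intro!: derivative_eq_intros simp: power2_eq_square)
    have "(?u' * (t + y) - ?u y) / (t + y)^2 = ?u' / (t + y) - ?u y / (t + y)^2"
      using pos by (simp add: diff_divide_distrib power2_eq_square)
    note u = u[unfolded this]
    have "((\<lambda>y. ln ((3 - 4 * y) * t + 6 * y)) has_real_derivative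
        (6 - 4 * t) / ((3 - 4 * y) * t + 6 * y)) (at y)"
      using E by (auto intro!: derivative_eq_intros simp: algebra_simps)
    moreover have "((\<lambda>y. ln (3 - 4 * y)) has_real_derivative - (4 / (3 - 4 * y))) (at y)"
      using pos by (auto intro!: derivative_eq_intros)
    moreover have "((\<lambda>y. y^4 / 400) has_real_derivative y^3 / 100) (at y)"
      by (auto intro!: derivative_eq_intros)
    ultimately have "(h has_real_derivative (6 - 4 * t) / ((3 - 4 * y) * t + 6 * y) - 0 - - (4 / (3 - 4 * y))
        - (?u' / (t + y) - ?u y / (t + y)^2) - y^3 / 100) (at y)"
      unfolding h_def by (intro DERIV_diff u DERIV_const)
    moreover have "0 \<le> (6 - 4 * t) / ((3 - 4 * y) * t + 6 * y) - 0 - - (4 / (3 - 4 * y))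
        - (?u' / (t + y) - ?u y / (t + y)^2) - y^3 / 100"
      using dkw_slope_nonneg[of y t] y assms by simp
    ultimately show "\<exists>d. (h has_real_derivative d) (at y) \<and> 0 \<le> d" by blast
  qed
  moreover have "h 0 = 0" using assms by (simp add: h_def ln_mult)
  ultimately have hx: "0 \<le> h x" by simp
  \<comment> \<open>Multiplying back by \<open>t + x\<close>, which is at least \<open>x\<close>,
    turns the slack \<open>x^4 / 400\<close> into one independent of \<open>t\<close>.\<close>
  have x5: "x^5 / 400 \<le> (t + x) * (x^4 / 400)"
    using assms mult_right_mono[of x "t + x" "x^4 / 400"] by (simp add: eval_nat_numeral)
  have L1: "ln (1 + 6 * x / (3 - 4 * x)) = ln (3 + 2 * x) - ln (3 - 4 * x)"
  proof -
    have "1 + 6 * x / (3 - 4 * x) = (3 + 2 * x) / (3 - 4 * x)" using assms by (simp add: field_simps)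
    then show ?thesis using assms by (simp add: ln_div)
  qed
  have L2: "ln (1 + 6 * x / (3 - 4 * x) / t) = ln ((3 - 4 * x) * t + 6 * x) - ln t - ln (3 - 4 * x)"
  proof -
    have "1 + 6 * x / (3 - 4 * x) / t = ((3 - 4 * x) * t + 6 * x) / (t * (3 - 4 * x))"
      using assms by (simp add: field_simps)
    moreover have "0 < (3 - 4 * x) * t + 6 * x" using assms by (simp add: add_pos_nonneg)
    ultimately show ?thesis using assms by (simp add: ln_div ln_mult)
  qed
  from hx have "0 \<le> ln (1 + 6 * x / (3 - 4 * x) / t) - (ln (1 + 6 * x / (3 - 4 * x)) + 2 * x^2) / (t + x) - x^4 / 400"
    unfolding L1 L2 h_def .
  then have "0 \<le> (t + x) * (ln (1 + 6 * x / (3 - 4 * x) / t) - (ln (1 + 6 * x / (3 - 4 * x)) + 2 * x^2) / (t + x) - x^4 / 400)"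
    using assms by simp
  also have "\<dots> = (t + x) * ln (1 + 6 * x / (3 - 4 * x) / t) - (ln (1 + 6 * x / (3 - 4 * x)) + 2 * x^2) - (t + x) * (x^4 / 400)"
    using assms by (simp add: right_diff_distrib)
  finally show ?thesis using x5 by linarith
qed

section \<open>The exponent for deviations of at least 1/2\<close>

lemma ln_ge_pade:
  fixes y :: real
  assumes "0 \<le> y" "y < 1"
  shows "2 * y + 2 / 3 * y^3 \<le> ln ((1 + y) / (1 - y))"
proof -
  define f where "f z = ln (1 + z) - ln (1 - z) - (2 * z + 2 / 3 * z^3)" for z :: real
  have "f 0 \<le> f y"
  proof (rule DERIV_nonneg_imp_nondecreasing[OF assms(1)])
    fix z assume z: "0 \<le> z" "z \<le> y"
    let ?d = "1 / (1 + z) + 1 / (1 - z) - (2 + 2 * z^2)"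
    have pos: "0 < 1 + z" "0 < 1 - z" using z assms by auto
    have "(f has_real_derivative ?d) (at z)"
      unfolding f_def using pos by (auto intro!: derivative_eq_intros simp: algebra_simps)
    \<comment> \<open>The cubic consists of the first two terms of the series of 2 artanh, so the
      derivative of the remainder starts with \<open>z^4\<close>.\<close>
    moreover have "?d = 2 * z^4 / ((1 + z) * (1 - z))"
      using pos by (simp add: divide_simps) (simp add: algebra_simps power2_eq_square power4_eq_xxxx)
    ultimately show "\<exists>d. (f has_real_derivative d) (at z) \<and> 0 \<le> d"
      using z pos by (intro exI[of _ ?d]) auto
  qed
  then show ?thesis using assms by (simp add: f_def ln_div)
qed

text \<open>This is the end point \<open>x = s\<close>, \<open>t = 1 - s\<close> for the parameter
  \<open>c = 3\<close>, where the factor \<open>t + x\<close> is 1.\<close>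

lemma dkw_exponent_endpoint:
  fixes s :: real
  assumes "1 / 2 \<le> s" "s < 1"
  shows "2 * s^2 + 1 / 1000 \<le> ln (1 + 3 / (1 - s)) - ln 4"
proof -
  \<comment> \<open>\<open>?y\<close> solves
    \<open>(1 + y) / (1 - y) = (1 + 3 / (1 - s)) / 4\<close>, which brings the difference of
    logarithms into the form of \<open>ln_ge_pade\<close>.\<close>
  let ?y = "3 * s / (8 - 5 * s)"
  have y: "0 \<le> ?y" "?y < 1" using assms by (auto simp: field_simps)
  have e: "1 + ?y = 2 * (4 - s) / (8 - 5 * s)" "1 - ?y = 2 * (4 * (1 - s)) / (8 - 5 * s)"
    using assms by (auto simp: field_simps)
  have cancel: "(2 * a / r) / (2 * b / r) = a / b" if "r \<noteq> 0" for a b r :: real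
    using that by simp
  have "(1 + ?y) / (1 - ?y) = (4 - s) / (4 * (1 - s))"
    unfolding e by (rule cancel) (use assms in simp)
  also have "\<dots> = (1 + 3 / (1 - s)) / 4" using assms by (simp add: field_simps)
  finally have eq: "(1 + ?y) / (1 - ?y) = (1 + 3 / (1 - s)) / 4" .
  have "0 < 1 + 3 / (1 - s)" using assms by (simp add: add_pos_pos)
  then have "ln ((1 + ?y) / (1 - ?y)) = ln (1 + 3 / (1 - s)) - ln 4"
    unfolding eq by (simp add: ln_div)
  moreover have "2 * s^2 + 1 / 1000 \<le> 2 * ?y + 2 / 3 * ?y^3"
  proof -
    define w where "w = 1 - s"
    have w: "0 < w" "w \<le> 1 / 2" using assms by (auto simp: w_def)
    \<comment> \<open>These give the tangents of \<open>w^2\<close> and \<open>w^3\<close> at 8/25,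
      close to where the quintic below is smallest. Its terms of degree 4 and 5 are first absorbed
      into the cubic one by \<open>w \<le> 1 / 2\<close>.\<close>
    have "0 \<le> (w - 8 / 25)^2" "0 \<le> (w - 8 / 25)^2 * (w + 16 / 25)" using w by simp_all
    then have w2: "16 / 25 * w - 64 / 625 \<le> w^2" and w3: "192 / 625 * w - 1024 / 15625 \<le> w^3"
      by (simp_all add: power2_eq_square power3_eq_cube field_simps)
    have step: "w^(Suc k) \<le> w^k / 2" for k
      using w mult_right_mono[of w "1/2" "w^k"] by simp
    have w5: "w^5 \<le> w^4 / 2" and w4: "w^4 \<le> w^3 / 2"
      using step[of 4] step[of 3] by (simp_all add: eval_nat_numeral)
    have "0 \<le> 17973 / 1000 - 18027 / 200 * w + 2391 / 40 * w^2 + 1695 / 8 * w^3 + 50 * w^4 - 250 * w^5"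
      using w2 w3 w4 w5 w by linarith
    also have "\<dots> = 6 * s * (8 - 5 * s)^2 + 18 * s^3 - (2 * s^2 + 1 / 1000) * (8 - 5 * s)^3"
      unfolding w_def by (simp add: field_simps power2_eq_square power3_eq_cube power4_eq_xxxx eval_nat_numeral)
    finally have "0 \<le> (6 * s * (8 - 5 * s)^2 + 18 * s^3 - (2 * s^2 + 1 / 1000) * (8 - 5 * s)^3) / (8 - 5 * s)^3"
      using assms by simp
    also have "\<dots> = 2 * (3 * s / r) + 2 / 3 * (3 * s / r)^3 - (2 * s^2 + 1 / 1000)" if "r = 8 - 5 * s" for r
    proof -
      have "r \<noteq> 0" using that assms by simp
      then show ?thesis unfolding that[symmetric] by (simp add: field_simps power2_eq_square power3_eq_cube)
    qed
    finally show ?thesis by simp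
  qed
  ultimately show ?thesis using ln_ge_pade[OF y] by linarith
qed

text \<open>
  For fixed \<open>t\<close> and \<open>c\<close> the difference of the two sides is concave in \<open>x\<close>, so it suffices to
  check the end points \<open>x = 1 / 2\<close> and \<open>x = 1 - t\<close>.
\<close>

lemma dkw_exponent_large:
  fixes x t :: real
  assumes "1 / 2 \<le> x" "0 < t" "t + x \<le> 1"
  shows "ln (1 + 3) + 2 * x^2 + 1 / 12800 \<le> (t + x) * ln (1 + 3 / t)"
proof -
  let ?l = "ln (1 + 3 / t)"
  \<comment> \<open>At \<open>x = 1 / 2\<close> the parameter \<open>6 * x / (3 - 4 * x)\<close>
    equals 3 and the slack \<open>x^5 / 400\<close> equals 1/12800.\<close>
  have half: "ln 4 + 1 / 2 + 1 / 12800 \<le> (t + 1 / 2) * ?l"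
    using dkw_exponent_small[of "1/2" t] assms by (simp add: power_divide)
  have endpt: "ln 4 + 2 * (1 - t)^2 + 1 / 1000 \<le> ?l"
    using dkw_exponent_endpoint[of "1 - t"] assms by simp
  show ?thesis
  \<comment> \<open>For \<open>t = 1 / 2\<close> the interval from 1/2 to \<open>1 - t\<close> is a
    single point and the weight \<open>l\<close> would have denominator 0.\<close>
  proof (cases "t = 1 / 2")
    case True
    then have "x = 1 / 2" using assms by simp
    show ?thesis using half unfolding \<open>x = 1 / 2\<close> by (simp add: power2_eq_square)
  next
    case False
    then have t: "0 < 1 / 2 - t" using assms by simp
    define l where "l = (x - 1 / 2) / (1 / 2 - t)"
    have l: "0 \<le> l" "l \<le> 1" using t assms by (auto simp: l_def)
    have x: "x = 1 / 2 + l * (1 / 2 - t)" using t by (simp add: l_def)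
    have "(1 - l) * (ln 4 + 1 / 2 + 1 / 12800) + l * (ln 4 + 2 * (1 - t)^2 + 1 / 1000)
      \<le> (1 - l) * ((t + 1 / 2) * ?l) + l * ?l"
      using l half endpt by (intro add_mono mult_left_mono) auto
    also have "\<dots> = ((1 - l) * (t + 1 / 2) + l) * ?l" by (simp add: algebra_simps)
    also have "(1 - l) * (t + 1 / 2) + l = t + x" unfolding x by (simp add: field_simps)
    finally have 1: "(1 - l) * (ln 4 + 1 / 2 + 1 / 12800) + l * (ln 4 + 2 * (1 - t)^2 + 1 / 1000) \<le> (t + x) * ?l" .
    \<comment> \<open>The exact amount by which the chord of the convex function
      \<open>2 * x^2\<close> lies above it.\<close>
    have "(1 - l) / 2 + l * (2 * (1 - t)^2) - 2 * x^2 = 2 * l * (1 - l) * (1 / 2 - t)^2"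
      unfolding x by (simp add: field_simps power2_eq_square)
    moreover have "0 \<le> 2 * l * (1 - l) * (1 / 2 - t)^2" using l by simp
    moreover have "(1 - l) * (ln 4 + 1 / 2 + 1 / 12800) + l * (ln 4 + 2 * (1 - t)^2 + 1 / 1000)
      = ln 4 + ((1 - l) / 2 + l * (2 * (1 - t)^2)) + 1 / 12800 + l * (1 / 1000 - 1 / 12800)"
      by (simp add: field_simps)
    moreover have "0 \<le> l * (1 / 1000 - 1 / 12800)" using l by simp
    ultimately show ?thesis using 1 by simp
  qed
qed

text \<open>Neither \<open>c\<close> nor \<open>\<eta>\<close> may depend on \<open>t\<close>: one
  change of measure has to serve all levels, and a uniform \<open>\<eta>\<close> keeps the final
  probability strictly below the bound.\<close>

lemma dkw_exponent:
  fixes x :: real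
  assumes "0 < x" "x < 1"
  obtains c \<eta> where "0 < c" "0 < \<eta>"
    "\<And>t. 0 < t \<Longrightarrow> t + x \<le> 1 \<Longrightarrow> ln (1 + c) + 2 * x^2 + \<eta> \<le> (t + x) * ln (1 + c / t)"
proof (cases "x \<le> 1 / 2")
  case True
  then show ?thesis
    using assms dkw_exponent_small by (intro that[of "6 * x / (3 - 4 * x)" "x^5 / 400"]) auto
next
  case False
  then show ?thesis
    using assms dkw_exponent_large by (intro that[of 3 "1 / 12800"]) auto
qed

section \<open>The one-sided Dvoretzky-Kiefer-Wolfowitz inequality\<close>

text \<open>
  The law \<open>q\<close> arises from \<open>p\<close> by adding mass \<open>c\<close> at the bottom cell and normalising. On the
  event \<open>A j\<close> that \<open>j\<close> is the last crossing, all sample values up to \<open>j\<close> may be merged, and after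
  the merging the density of \<open>q\<close> with respect to \<open>p\<close> only depends on the number of samples
  in the merged cell.
\<close>

lemma product_pmf_first_crossing_le:
  fixes p :: "nat pmf" and c \<epsilon> \<eta> :: real and n m :: nat
  assumes n: "1 \<le> n" and c: "0 < c" and \<epsilon>: "0 < \<epsilon>"
    and exponent: "\<And>t. 0 < t \<Longrightarrow> t + \<epsilon> \<le> 1 \<Longrightarrow> ln (1 + c) + \<eta> \<le> (t + \<epsilon>) * ln (1 + c / t)"
  defines "C \<equiv> \<lambda>z j. real n * (measure (measure_pmf p) {..j} + \<epsilon>) < real (card {i\<in>{1..n}. z i \<le> j})"
  shows "measure (measure_pmf (Pi_pmf {1..n} 0 (\<lambda>_. p))) {z. \<exists>j<m. C z j} \<le> exp (- real n * \<eta>)"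
proof -
  define q :: "nat pmf" where
    "q = bind_pmf (bernoulli_pmf (c / (1 + c))) (\<lambda>b. if b then return_pmf 0 else p)"
  define A where "A j = {z. C z j \<and> (\<forall>l. j < l \<and> l < m \<longrightarrow> \<not> C z l)}" for j
  let ?P = "Pi_pmf {1..n} 0 (\<lambda>_. p)"
  let ?Q = "Pi_pmf {1..n} 0 (\<lambda>_. q)"
  have cprob: "0 \<le> c / (1 + c)" "c / (1 + c) \<le> 1" using c by (auto simp: field_simps)
  \<comment> \<open>Stated for every relabelling \<open>f\<close>: the added mass moves from 0 to
    \<open>f 0\<close>, hence into the merged cell \<open>j\<close> when
    \<open>f = max j\<close>.\<close>
  have pmf_q: "pmf (map_pmf f q) k = (pmf (map_pmf f p) k + (if k = f 0 then c else 0)) / (1 + c)"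
    for f :: "nat \<Rightarrow> nat" and k
  proof -
    have "map_pmf f q = bind_pmf (bernoulli_pmf (c / (1 + c))) (\<lambda>b. if b then return_pmf (f 0) else map_pmf f p)"
      unfolding q_def by (auto simp: map_bind_pmf intro!: bind_pmf_cong)
    then have "pmf (map_pmf f q) k = c / (1 + c) * pmf (return_pmf (f 0)) k + (1 - c / (1 + c)) * pmf (map_pmf f p) k"
      using cprob by (simp add: pmf_bind)
    also have "\<dots> = (pmf (map_pmf f p) k + (if k = f 0 then c else 0)) / (1 + c)"
    proof -
      have "1 - c / (1 + c) = 1 / (1 + c)" using c by (simp add: field_simps)
      then show ?thesis by (simp add: add_divide_distrib)
    qed
    finally show ?thesis .
  qed
  \<comment> \<open>Replacing values by their maximum with \<open>j\<close> changes no count at a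
    level \<open>l \<ge> j\<close>, and \<open>A j\<close> refers to no other levels.\<close>
  have inv: "(max j \<circ> z \<in> A j) = (z \<in> A j)" for z j
  proof -
    have "C (max j \<circ> z) l = C z l" if "j \<le> l" for l
    proof -
      have "(max j (z i) \<le> l) = (z i \<le> l)" for i using that by simp
      then show ?thesis by (simp add: C_def)
    qed
    then show ?thesis by (auto simp: A_def)
  qed
  \<comment> \<open>The default value outside \<open>{1..n}\<close> is mapped as well, from 0 to
    \<open>max j 0 = j\<close>.\<close>
  have collapse: "emeasure (Pi_pmf {1..n} 0 (\<lambda>_. r)) (A j) = emeasure (Pi_pmf {1..n} j (\<lambda>_. map_pmf (max j) r)) (A j)"
    for r :: "nat pmf" and j
    by (subst Pi_pmf_map[where dflt = 0]) (auto simp: vimage_def inv)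
  have ratio: "ennreal (exp (real n * \<eta>)) * emeasure ?P (A j) \<le> emeasure ?Q (A j)" for j
  proof -
    let ?p = "map_pmf (max j) p"
    let ?q = "map_pmf (max j) q"
    have pt: "exp (real n * \<eta>) * pmf (Pi_pmf {1..n} j (\<lambda>_. ?p)) z \<le> pmf (Pi_pmf {1..n} j (\<lambda>_. ?q)) z"
      if z: "z \<in> A j" for z
    proof (cases "pmf (Pi_pmf {1..n} j (\<lambda>_. ?p)) z = 0")
      case False
      then have dflt: "\<forall>x. x \<notin> {1..n} \<longrightarrow> z x = j" by (metis pmf_Pi_outside finite_atLeastAtMost)
      then have eqp: "pmf (Pi_pmf {1..n} j (\<lambda>_. ?p)) z = (\<Prod>i\<in>{1..n}. pmf ?p (z i))"
        and eqq: "pmf (Pi_pmf {1..n} j (\<lambda>_. ?q)) z = (\<Prod>i\<in>{1..n}. pmf ?q (z i))"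
        by (auto intro!: pmf_Pi')
      have pos: "pmf ?p (z i) \<noteq> 0" if "i \<in> {1..n}" for i
        using False that unfolding eqp by simp
      have ge: "j \<le> z i" if "i \<in> {1..n}" for i
        using pos[OF that] by (auto simp: pmf_eq_0_set_pmf)
      define t where "t = measure (measure_pmf p) {..j}"
      have pj: "pmf ?p j = t"
        by (auto simp: pmf_map t_def vimage_def max_def intro!: arg_cong[where f = "measure _"])
      define K where "K = {i\<in>{1..n}. z i = j}"
      have "{i\<in>{1..n}. z i \<le> j} = K" using ge by (auto simp: K_def intro: antisym)
      with z have K: "real n * (t + \<epsilon>) < real (card K)"
        by (simp add: A_def C_def t_def)
      have "0 \<le> t" by (simp add: t_def)
      have "0 \<le> real n * (t + \<epsilon>)" using \<open>0 \<le> t\<close> \<epsilon> by simp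
      with K have "K \<noteq> {}" by auto
      \<comment> \<open>A crossing puts some sample into the merged cell with positive probability,
        which excludes \<open>t = 0\<close> before \<open>c / t\<close> is used.\<close>
      then obtain i where "i \<in> {1..n}" "z i = j" by (auto simp: K_def)
      with pos[of i] \<open>0 \<le> t\<close> have t: "0 < t" by (simp add: pj)
      have "card K \<le> card {1..n}" unfolding K_def by (intro card_mono) auto
      with K have "real n * (t + \<epsilon>) \<le> real n * 1" by simp
      from mult_left_le_imp_le[OF this] n have t1: "t + \<epsilon> \<le> 1" by simp
      \<comment> \<open>Every sample contributes \<open>1 / (1 + c)\<close> to the likelihood ratio,
        and one in the merged cell an additional \<open>1 + c / t\<close>.\<close>
      have "(\<Prod>i\<in>{1..n}. pmf ?q (z i)) = (\<Prod>i\<in>{1..n}. pmf ?p (z i) / (1 + c) * (if z i = j then 1 + c / t else 1))"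
        using t c by (intro prod.cong) (auto simp: pmf_q pj field_simps)
      also have "\<dots> = (\<Prod>i\<in>{1..n}. pmf ?p (z i)) / (1 + c)^n * (1 + c / t)^card K"
        by (simp add: prod.distrib prod_dividef prod.If_cases K_def Int_def)
      also have "\<dots> = (\<Prod>i\<in>{1..n}. pmf ?p (z i)) * exp (real (card K) * ln (1 + c / t) - real n * ln (1 + c))"
        using c t by (simp add: exp_diff exp_of_nat_mult add_pos_pos)
      also have "\<dots> \<ge> (\<Prod>i\<in>{1..n}. pmf ?p (z i)) * exp (real n * \<eta>)"
      proof (intro mult_left_mono prod_nonneg)
        have "real n * (ln (1 + c) + \<eta>) \<le> real n * ((t + \<epsilon>) * ln (1 + c / t))"
          using exponent[OF t t1] by (intro mult_left_mono) auto
        also have "\<dots> = real n * (t + \<epsilon>) * ln (1 + c / t)" by simp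
        also have "\<dots> \<le> real (card K) * ln (1 + c / t)"
          using K c t by (intro mult_right_mono) auto
        finally show "exp (real n * \<eta>) \<le> exp (real (card K) * ln (1 + c / t) - real n * ln (1 + c))"
          by (simp add: algebra_simps)
      qed auto
      finally show ?thesis unfolding eqp eqq by (simp add: mult.commute)
    qed simp
    have "ennreal (exp (real n * \<eta>)) * emeasure (Pi_pmf {1..n} j (\<lambda>_. ?p)) (A j)
      = (\<integral>\<^sup>+z. ennreal (exp (real n * \<eta>) * pmf (Pi_pmf {1..n} j (\<lambda>_. ?p)) z) \<partial>count_space (A j))"
      by (simp add: nn_integral_pmf[symmetric] nn_integral_cmult ennreal_mult)
    also have "\<dots> \<le> (\<integral>\<^sup>+z. ennreal (pmf (Pi_pmf {1..n} j (\<lambda>_. ?q)) z) \<partial>count_space (A j))"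
      by (intro nn_integral_mono ennreal_leI) (use pt in simp)
    also have "\<dots> = emeasure (Pi_pmf {1..n} j (\<lambda>_. ?q)) (A j)" by (simp add: nn_integral_pmf)
    finally show ?thesis unfolding collapse .
  qed
  have ratio': "exp (real n * \<eta>) * measure ?P (A j) \<le> measure ?Q (A j)" for j
    using ratio[of j] by (simp add: measure_pmf.emeasure_eq_measure ennreal_mult[symmetric])
  have disj: "disjoint_family_on A {..<m}"
    unfolding disjoint_family_on_def A_def by (auto simp: neq_iff)
  have union: "{z. \<exists>j<m. C z j} = (\<Union>j\<in>{..<m}. A j)"
  proof (intro equalityI subsetI)
    fix z assume "z \<in> {z. \<exists>j<m. C z j}"
    then have ne: "{j. j < m \<and> C z j} \<noteq> {}" by auto
    define j where "j = Max {j. j < m \<and> C z j}"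
    have "j \<in> {j. j < m \<and> C z j}" unfolding j_def using ne by (intro Max_in) auto
    moreover have "\<not> C z l" if "j < l" "l < m" for l
    proof
      assume "C z l"
      with that have "l \<le> j" unfolding j_def by (intro Max_ge) auto
      with that show False by simp
    qed
    ultimately have "j \<in> {..<m}" "z \<in> A j" by (simp_all add: A_def)
    then show "z \<in> (\<Union>j\<in>{..<m}. A j)" by blast
  qed (auto simp: A_def)
  \<comment> \<open>The last-crossing events are disjoint, so their masses under \<open>?Q\<close>
    sum to at most 1 and no factor \<open>m\<close> appears.\<close>
  have "exp (real n * \<eta>) * measure ?P {z. \<exists>j<m. C z j} = (\<Sum>j<m. exp (real n * \<eta>) * measure ?P (A j))"
    unfolding union using disj by (subst measure_pmf.finite_measure_finite_Union) (auto simp: sum_distrib_left)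
  also have "\<dots> \<le> (\<Sum>j<m. measure ?Q (A j))" by (intro sum_mono ratio')
  also have "\<dots> = measure ?Q (\<Union>j\<in>{..<m}. A j)"
    using disj by (subst measure_pmf.finite_measure_finite_Union) auto
  also have "\<dots> \<le> 1" by simp
  finally show ?thesis by (simp add: exp_minus field_simps)
qed

section \<open>Reduction of real samples to finitely many cells\<close>

lemma (in prob_space) ex_pmf_law:
  fixes Z :: "'a \<Rightarrow> nat"
  assumes [measurable]: "Z \<in> measurable M (count_space UNIV)"
  obtains p :: "nat pmf" where "\<And>A. measure (measure_pmf p) A = prob {\<omega> \<in> space M. Z \<omega> \<in> A}"
proof -
  let ?D = "distr M (count_space UNIV) Z"
  interpret D: prob_space ?D by (rule prob_space_distr) simp
  have "AE x in ?D. measure ?D {x} \<noteq> 0"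
    by (subst D.AE_support_countable) (auto intro!: exI[of _ UNIV])
  then have "measure_pmf (Abs_pmf ?D) = ?D"
    by (intro Abs_pmf_inverse) (auto intro: D.prob_space_axioms)
  then show ?thesis
    by (intro that[of "Abs_pmf ?D"]) (auto simp: measure_distr vimage_def Int_def conj_commute)
qed

text \<open>The points of \<open>T\<close> cut the line into cells, and whether a sample is at most
  some \<open>t \<in> T\<close> depends only on its cell. The vector of cell indices has a product
  law on natural numbers, to which the crossing bound applies.\<close>

lemma dkw_finite_set:
  fixes N :: "'a measure" and M :: "'b measure" and X :: "'a \<Rightarrow> real" and Xs :: "nat \<Rightarrow> 'b \<Rightarrow> real"
  assumes N: "prob_space N" and X[measurable]: "X \<in> borel_measurable N"
    and M: "prob_space M" and indep: "prob_space.indep_vars M (\<lambda>_. borel) Xs {1..n}"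
    and law: "\<And>i. i \<in> {1..n} \<Longrightarrow> distr M borel (Xs i) = distr N borel X"
    and n: "1 \<le> n" and c: "0 < c" and \<epsilon>: "0 < \<epsilon>"
    and exponent: "\<And>t. 0 < t \<Longrightarrow> t + \<epsilon> \<le> 1 \<Longrightarrow> ln (1 + c) + \<eta> \<le> (t + \<epsilon>) * ln (1 + c / t)"
    and T: "finite T"
  shows "\<P>(\<omega> in M. \<exists>t\<in>T. real n * (\<P>(x in N. X x \<le> t) + \<epsilon>) < real (card {i\<in>{1..n}. Xs i \<omega> \<le> t}))
    \<le> exp (- real n * \<eta>)"
proof -
  interpret N: prob_space N by fact
  interpret M: prob_space M by fact
  have Xs[measurable]: "Xs i \<in> borel_measurable M" if "i \<in> {1..n}" for i
    using indep that by (auto simp: M.indep_vars_def)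
  \<comment> \<open>The strict inequality matters: if \<open>t < x\<close>, then \<open>t\<close> is
    counted in \<open>cell x\<close> but not in \<open>rank t\<close>, so closed half-lines become
    initial segments.\<close>
  define cell where "cell x = card {t\<in>T. t < x}" for x :: real
  define rank where "rank t = card {s\<in>T. s < t}" for t :: real
  have cell_le: "cell x \<le> rank t \<longleftrightarrow> x \<le> t" if "t \<in> T" for x t
  proof
    assume "x \<le> t"
    then show "cell x \<le> rank t" using T unfolding cell_def rank_def by (intro card_mono) auto
  next
    assume le: "cell x \<le> rank t"
    show "x \<le> t"
    proof (rule ccontr)
      assume "\<not> x \<le> t"
      then have "t \<in> {s\<in>T. s < x} - {s\<in>T. s < t}" "{s\<in>T. s < t} \<subseteq> {s\<in>T. s < x}"
        using that by auto
      then have "{s\<in>T. s < t} \<subset> {s\<in>T. s < x}" by blast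
      from psubset_card_mono[OF _ this] T have "rank t < cell x" by (simp add: cell_def rank_def)
      with le show False by simp
    qed
  qed
  have cell_bound: "cell x \<le> card T" for x
    unfolding cell_def using T by (intro card_mono) auto
  have rank_bound: "rank t < Suc (card T)" for t
    unfolding rank_def less_Suc_eq_le using T by (intro card_mono) auto
  have cell_meas[measurable]: "cell \<in> measurable borel (count_space UNIV)"
  proof -
    have "cell = (\<lambda>x. \<Sum>t\<in>T. if t < x then 1 else 0)"
      using T by (auto simp: cell_def fun_eq_iff sum.If_cases Int_def)
    then show ?thesis by simp
  qed
  obtain p :: "nat pmf" where p: "\<And>A. measure (measure_pmf p) A = \<P>(x in N. cell (X x) \<in> A)"
    using N.ex_pmf_law[of "\<lambda>x. cell (X x)"] by auto
  have pXs: "\<P>(\<omega> in M. cell (Xs i \<omega>) \<in> A) = measure (measure_pmf p) A" if "i \<in> {1..n}" for i A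
  proof -
    have "\<P>(\<omega> in M. cell (Xs i \<omega>) \<in> A) = measure (distr M borel (Xs i)) (cell -` A)"
      using that by (subst measure_distr) (auto simp: vimage_def Int_def conj_commute intro!: measurable_sets_borel[OF cell_meas])
    also have "\<dots> = \<P>(x in N. cell (X x) \<in> A)"
      unfolding law[OF that] by (subst measure_distr) (auto simp: vimage_def Int_def conj_commute intro!: measurable_sets_borel[OF cell_meas])
    finally show ?thesis by (simp add: p)
  qed
  define C where "C z j \<longleftrightarrow> real n * (measure (measure_pmf p) {..j} + \<epsilon>) < real (card {i\<in>{1..n}. z i \<le> j})"
    for z :: "nat \<Rightarrow> nat" and j
  define E where "E = {z. \<exists>j<Suc (card T). C z j}"
  \<comment> \<open>Only finitely many index vectors can occur, so the event is covered by finitely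
    many atoms \<open>G z\<close>, whose probabilities are given by independence.\<close>
  let ?S = "PiE_dflt {1..n} 0 (\<lambda>_. {..card T})"
  define G where "G z = {\<omega>\<in>space M. \<forall>i\<in>{1..n}. cell (Xs i \<omega>) = z i}" for z
  have finS: "finite ?S" by (intro finite_PiE_dflt) auto
  have G_sets: "G z \<in> sets M" for z unfolding G_def by measurable
  have G_prob: "M.prob (G z) = pmf (Pi_pmf {1..n} 0 (\<lambda>_. p)) z" if "z \<in> ?S" for z
  proof -
    have "M.prob (\<Inter>i\<in>{1..n}. Xs i -` (cell -` {z i}) \<inter> space M) = (\<Prod>i\<in>{1..n}. M.prob (Xs i -` (cell -` {z i}) \<inter> space M))"
      using n by (intro M.indep_varsD[OF indep]) (auto intro!: measurable_sets_borel[OF cell_meas])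
    also have "\<dots> = (\<Prod>i\<in>{1..n}. pmf p (z i))"
    proof (intro prod.cong refl)
      fix i assume "i \<in> {1..n}"
      from pXs[OF this, of "{z i}"] show "M.prob (Xs i -` (cell -` {z i}) \<inter> space M) = pmf p (z i)"
        by (simp add: vimage_def Int_def conj_commute pmf.rep_eq)
    qed
    also have "\<dots> = pmf (Pi_pmf {1..n} 0 (\<lambda>_. p)) z"
      using that by (subst pmf_Pi') (auto simp: PiE_dflt_def)
    also have "(\<Inter>i\<in>{1..n}. Xs i -` (cell -` {z i}) \<inter> space M) = G z"
      using n by (auto simp: G_def)
    finally show ?thesis .
  qed
  have "{\<omega>\<in>space M. \<exists>t\<in>T. real n * (\<P>(x in N. X x \<le> t) + \<epsilon>) < real (card {i\<in>{1..n}. Xs i \<omega> \<le> t})}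
    \<subseteq> (\<Union>z\<in>E \<inter> ?S. G z)"
  proof safe
    fix \<omega> t assume \<omega>: "\<omega> \<in> space M" and t: "t \<in> T"
      and *: "real n * (\<P>(x in N. X x \<le> t) + \<epsilon>) < real (card {i\<in>{1..n}. Xs i \<omega> \<le> t})"
    define z where "z i = (if i \<in> {1..n} then cell (Xs i \<omega>) else 0)" for i
    have "C z (rank t)"
    proof -
      have "{i\<in>{1..n}. z i \<le> rank t} = {i\<in>{1..n}. Xs i \<omega> \<le> t}"
        using cell_le[OF t] by (auto simp: z_def)
      moreover have "measure (measure_pmf p) {..rank t} = \<P>(x in N. X x \<le> t)"
        by (simp add: p cell_le[OF t])
      ultimately show ?thesis using * by (simp add: C_def)
    qed
    then have "z \<in> E" using rank_bound[of t] by (auto simp: E_def)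
    moreover have "z \<in> ?S" using cell_bound by (auto simp: z_def PiE_dflt_def)
    moreover have "\<omega> \<in> G z" using \<omega> by (auto simp: G_def z_def)
    ultimately show "\<omega> \<in> (\<Union>z\<in>E \<inter> ?S. G z)" by blast
  qed
  then have "\<P>(\<omega> in M. \<exists>t\<in>T. real n * (\<P>(x in N. X x \<le> t) + \<epsilon>) < real (card {i\<in>{1..n}. Xs i \<omega> \<le> t}))
    \<le> M.prob (\<Union>z\<in>E \<inter> ?S. G z)"
    using finS G_sets by (intro M.finite_measure_mono) auto
  also have "\<dots> \<le> (\<Sum>z\<in>E \<inter> ?S. M.prob (G z))"
    using finS G_sets by (intro M.finite_measure_subadditive_finite) auto
  also have "\<dots> = measure (Pi_pmf {1..n} 0 (\<lambda>_. p)) (E \<inter> ?S)"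
    using finS by (subst measure_measure_pmf_finite) (auto simp: G_prob)
  also have "\<dots> \<le> measure (Pi_pmf {1..n} 0 (\<lambda>_. p)) E"
    by (intro measure_pmf.finite_measure_mono) auto
  also have "\<dots> \<le> exp (- real n * \<eta>)"
    unfolding E_def C_def by (rule product_pmf_first_crossing_le[OF n c \<epsilon> exponent])
  finally show ?thesis .
qed

lemma card_le_measurable:
  fixes Xs :: "nat \<Rightarrow> 'b \<Rightarrow> real"
  assumes [measurable]: "\<And>i. i \<in> {1..n} \<Longrightarrow> Xs i \<in> borel_measurable M"
  shows "(\<lambda>\<omega>. real (card {i\<in>{1..n}. Xs i \<omega> \<le> t})) \<in> borel_measurable M"
proof -
  have "(\<lambda>\<omega>. real (card {i\<in>{1..n}. Xs i \<omega> \<le> t})) = (\<lambda>\<omega>. \<Sum>i\<in>{1..n}. if Xs i \<omega> \<le> t then 1 else 0)"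
    by (auto simp: fun_eq_iff sum.If_cases Int_def)
  then show ?thesis by simp
qed

text \<open>
  Massart's constant is obtained here without the usual restriction to failure probabilities
  at most \<open>1 / 2\<close>.
\<close>

lemma dkw_one_sided:
  fixes N :: "'a measure" and M :: "'b measure" and X :: "'a \<Rightarrow> real" and Xs :: "nat \<Rightarrow> 'b \<Rightarrow> real"
  assumes N: "prob_space N" and X[measurable]: "X \<in> borel_measurable N"
    and M: "prob_space M" and indep: "prob_space.indep_vars M (\<lambda>_. borel) Xs {1..n}"
    and law: "\<And>i. i \<in> {1..n} \<Longrightarrow> distr M borel (Xs i) = distr N borel X"
    and n: "1 \<le> n" and \<epsilon>: "0 < \<epsilon>"
  shows "{\<omega>\<in>space M. \<exists>t\<in>\<rat>. real n * (\<P>(x in N. X x \<le> t) + \<epsilon>) < real (card {i\<in>{1..n}. Xs i \<omega> \<le> t})} \<in> sets M"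
    and "\<P>(\<omega> in M. \<exists>t\<in>\<rat>. real n * (\<P>(x in N. X x \<le> t) + \<epsilon>) < real (card {i\<in>{1..n}. Xs i \<omega> \<le> t}))
      < exp (- 2 * real n * \<epsilon>^2)"
proof -
  interpret N: prob_space N by fact
  interpret M: prob_space M by fact
  have Xs[measurable]: "Xs i \<in> borel_measurable M" if "i \<in> {1..n}" for i
    using indep that by (auto simp: M.indep_vars_def)
  define F where "F t \<omega> \<longleftrightarrow> real n * (\<P>(x in N. X x \<le> t) + \<epsilon>) < real (card {i\<in>{1..n}. Xs i \<omega> \<le> t})" for t \<omega>
  have F_sets: "{\<omega>\<in>space M. F t \<omega>} \<in> sets M" for t
    unfolding F_def using card_le_measurable[of n Xs M t] Xs by measurable
  have "{\<omega>\<in>space M. \<exists>t\<in>\<rat>. F t \<omega>} = (\<Union>t\<in>\<rat>. {\<omega>\<in>space M. F t \<omega>})" by auto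
  also have "\<dots> \<in> sets M" using F_sets countable_rat by (intro sets.countable_UN') auto
  finally show "{\<omega>\<in>space M. \<exists>t\<in>\<rat>. real n * (\<P>(x in N. X x \<le> t) + \<epsilon>) < real (card {i\<in>{1..n}. Xs i \<omega> \<le> t})} \<in> sets M"
    by (simp add: F_def)
  have "\<P>(\<omega> in M. \<exists>t\<in>\<rat>. F t \<omega>) < exp (- 2 * real n * \<epsilon>^2)"
  proof (cases "\<epsilon> < 1")
    case True
    obtain c \<eta> where c: "0 < c" and \<eta>: "0 < \<eta>"
      and exponent: "\<And>t. 0 < t \<Longrightarrow> t + \<epsilon> \<le> 1 \<Longrightarrow> ln (1 + c) + 2 * \<epsilon>^2 + \<eta> \<le> (t + \<epsilon>) * ln (1 + c / t)"
      using dkw_exponent[OF \<epsilon> True] by metis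
    define r :: "nat \<Rightarrow> real" where "r = from_nat_into \<rat>"
    have r: "range r = \<rat>"
      unfolding r_def by (intro range_from_nat_into countable_rat) auto
    \<comment> \<open>Finite sets of rationals increase to all rationals; as \<open>\<eta>\<close>
      does not depend on \<open>k\<close>, the strict inequality survives the limit.\<close>
    let ?A = "\<lambda>k. {\<omega>\<in>space M. \<exists>t\<in>r ` {..k}. F t \<omega>}"
    have A_sets: "?A k \<in> sets M" for k
    proof -
      have "?A k = (\<Union>t\<in>r ` {..k}. {\<omega>\<in>space M. F t \<omega>})" by auto
      then show ?thesis using F_sets by auto
    qed
    have "(\<lambda>k. M.prob (?A k)) \<longlonglongrightarrow> M.prob (\<Union>k. ?A k)"
    proof (rule M.finite_Lim_measure_incseq)
      show "range ?A \<subseteq> M.events" using A_sets by blast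
      show "incseq ?A" by (auto simp: incseq_def)
    qed
    also have "(\<Union>k. ?A k) = {\<omega>\<in>space M. \<exists>t\<in>\<rat>. F t \<omega>}"
      unfolding r[symmetric] by auto
    finally have lim: "(\<lambda>k. M.prob (?A k)) \<longlonglongrightarrow> M.prob {\<omega>\<in>space M. \<exists>t\<in>\<rat>. F t \<omega>}" .
    have "M.prob (?A k) \<le> exp (- real n * (2 * \<epsilon>^2 + \<eta>))" for k
      unfolding F_def using exponent
      by (intro dkw_finite_set[OF N X M indep law n c \<epsilon>]) (auto simp: add.assoc)
    then have "M.prob {\<omega>\<in>space M. \<exists>t\<in>\<rat>. F t \<omega>} \<le> exp (- real n * (2 * \<epsilon>^2 + \<eta>))"
      by (intro LIMSEQ_le_const2[OF lim]) auto
    also have "\<dots> < exp (- 2 * real n * \<epsilon>^2)" using n \<eta> by (simp add: algebra_simps)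
    finally show ?thesis .
  next
    case False
    \<comment> \<open>A count never exceeds \<open>n\<close>, so for
      \<open>\<epsilon> \<ge> 1\<close> there is no crossing and the probability is 0.\<close>
    have "\<not> F t \<omega>" for t \<omega>
    proof -
      have "card {i\<in>{1..n}. Xs i \<omega> \<le> t} \<le> card {1..n}" by (intro card_mono) auto
      then have "real (card {i\<in>{1..n}. Xs i \<omega> \<le> t}) \<le> real n * 1" by simp
      also have "\<dots> \<le> real n * (\<P>(x in N. X x \<le> t) + \<epsilon>)"
        using False N.prob_space by (intro mult_left_mono) (auto simp: add_increasing)
      finally show ?thesis by (simp add: F_def)
    qed
    then show ?thesis by simp
  qed
  then show "\<P>(\<omega> in M. \<exists>t\<in>\<rat>. real n * (\<P>(x in N. X x \<le> t) + \<epsilon>) < real (card {i\<in>{1..n}. Xs i \<omega> \<le> t}))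
      < exp (- 2 * real n * \<epsilon>^2)"
    by (simp add: F_def)
qed

section \<open>CVaR under a one-sided comparison of tails\<close>

lemma nn_integral_layer:
  fixes x w v :: real
  assumes "w \<le> v"
  shows "(\<integral>\<^sup>+t. (if w \<le> t \<and> t \<le> v \<and> t < x then 1 else 0) \<partial>lborel) = ennreal (max (x - w) 0 - max (x - v) 0)"
proof -
  have "(\<integral>\<^sup>+t. (if w \<le> t \<and> t \<le> v \<and> t < x then 1 else 0) \<partial>lborel)
      = (\<integral>\<^sup>+t. indicator ({w..v} \<inter> {..<x}) t \<partial>lborel)"
    by (intro nn_integral_cong) (auto simp: indicator_def)
  also have "\<dots> = emeasure lborel ({w..v} \<inter> {..<x})" by simp
  also have "\<dots> = ennreal (max (x - w) 0 - max (x - v) 0)"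
  proof (cases "x \<le> v")
    case True
    then have "{w..v} \<inter> {..<x} = {w..<x}" by auto
    then show ?thesis using True by (cases "w \<le> x") (auto simp: max_def)
  next
    case False
    then have "{w..v} \<inter> {..<x} = {w..v}" by auto
    then show ?thesis using False assms by (auto simp: max_def)
  qed
  finally show ?thesis .
qed

text \<open>Fubini for the indicator of \<open>t < X \<omega>\<close>. A difference of two excesses
  involves only the bounded interval \<open>{w..v}\<close>, on which a uniform error in the tails
  has a finite cost.\<close>

lemma (in prob_space) excess_layer_cake:
  fixes X :: "'a \<Rightarrow> real"
  assumes X[measurable]: "X \<in> borel_measurable M" and "w \<le> v"
  shows "(\<integral>\<^sup>+\<omega>. ennreal (max (X \<omega> - w) 0 - max (X \<omega> - v) 0) \<partial>M)
    = (\<integral>\<^sup>+t. ennreal \<P>(\<omega> in M. t < X \<omega>) * indicator {w..v} t \<partial>lborel)"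
proof -
  interpret P: pair_sigma_finite M lborel ..
  let ?f = "\<lambda>\<omega> t. if w \<le> t \<and> t \<le> v \<and> t < X \<omega> then 1 else 0 :: ennreal"
  have "(\<integral>\<^sup>+\<omega>. ennreal (max (X \<omega> - w) 0 - max (X \<omega> - v) 0) \<partial>M) = (\<integral>\<^sup>+\<omega>. (\<integral>\<^sup>+t. ?f \<omega> t \<partial>lborel) \<partial>M)"
    using nn_integral_layer[OF \<open>w \<le> v\<close>] by simp
  also have "\<dots> = (\<integral>\<^sup>+t. (\<integral>\<^sup>+\<omega>. ?f \<omega> t \<partial>M) \<partial>lborel)"
    by (rule P.Fubini'[symmetric]) measurable
  also have "\<dots> = (\<integral>\<^sup>+t. ennreal \<P>(\<omega> in M. t < X \<omega>) * indicator {w..v} t \<partial>lborel)"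
  proof (intro nn_integral_cong)
    fix t
    have "(\<integral>\<^sup>+\<omega>. ?f \<omega> t \<partial>M) = (\<integral>\<^sup>+\<omega>. indicator {w..v} t * indicator {\<omega>\<in>space M. t < X \<omega>} \<omega> \<partial>M)"
      by (intro nn_integral_cong) (auto simp: indicator_def)
    also have "\<dots> = ennreal \<P>(\<omega> in M. t < X \<omega>) * indicator {w..v} t"
      by (subst nn_integral_cmult) (auto simp: emeasure_eq_measure mult.commute)
    finally show "(\<integral>\<^sup>+\<omega>. ?f \<omega> t \<partial>M) = ennreal \<P>(\<omega> in M. t < X \<omega>) * indicator {w..v} t" .
  qed
  finally show ?thesis .
qed

section \<open>The expected excess over a threshold (stop-loss transform)\<close>

abbreviation excess :: "'a measure \<Rightarrow> ('a \<Rightarrow> real) \<Rightarrow> real \<Rightarrow> real" where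
  "excess M X w \<equiv> (\<integral>\<omega>. max (X \<omega> - w) 0 \<partial>M)"

lemma (in prob_space) integrable_excess:
  fixes X :: "'a \<Rightarrow> real"
  assumes "integrable M X"
  shows "integrable M (\<lambda>\<omega>. max (X \<omega> - w) 0)"
  using assms by simp

lemma excess_nonneg: "0 \<le> excess M X w"
  by (intro Bochner_Integration.integral_nonneg) simp

lemma (in prob_space) excess_antimono:
  fixes X :: "'a \<Rightarrow> real"
  assumes "integrable M X" "w \<le> v"
  shows "excess M X v \<le> excess M X w"
  using assms by (intro integral_mono integrable_excess) auto

lemma (in prob_space) excess_ge_mean:
  fixes X :: "'a \<Rightarrow> real"
  assumes "integrable M X"
  shows "expectation X - w \<le> excess M X w"
proof -
  have "expectation X - w = (\<integral>\<omega>. X \<omega> - w \<partial>M)" using assms by (simp add: prob_space)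
  also have "\<dots> \<le> excess M X w" using assms by (intro integral_mono integrable_excess) auto
  finally show ?thesis .
qed

lemma (in prob_space) excess_diff:
  fixes X :: "'a \<Rightarrow> real"
  assumes X: "integrable M X" and "w \<le> v"
  shows "ennreal (excess M X w - excess M X v)
    = (\<integral>\<^sup>+t. ennreal \<P>(\<omega> in M. t < X \<omega>) * indicator {w..v} t \<partial>lborel)"
proof -
  have "excess M X w - excess M X v = (\<integral>\<omega>. max (X \<omega> - w) 0 - max (X \<omega> - v) 0 \<partial>M)"
    using X by (intro Bochner_Integration.integral_diff[symmetric] integrable_excess)
  then have "ennreal (excess M X w - excess M X v) = (\<integral>\<^sup>+\<omega>. ennreal (max (X \<omega> - w) 0 - max (X \<omega> - v) 0) \<partial>M)"
    using \<open>w \<le> v\<close> X by (subst nn_integral_eq_integral) (auto intro!: Bochner_Integration.integrable_diff integrable_excess)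
  then show ?thesis using X by (subst (asm) excess_layer_cake[OF _ \<open>w \<le> v\<close>]) auto
qed

text \<open>The tail inequality integrated over \<open>{w..v}\<close>. The CVaR bounds below use the
  comparison of the two distributions only in this form.\<close>

lemma excess_diff_le:
  fixes X :: "'a \<Rightarrow> real" and Y :: "'b \<Rightarrow> real"
  assumes N: "prob_space N" "integrable N X" and L: "prob_space L" "integrable L Y"
    and tail: "\<And>t. \<P>(\<omega> in N. t < X \<omega>) \<le> \<P>(\<omega> in L. t < Y \<omega>) + \<epsilon>"
    and "0 \<le> \<epsilon>" "w \<le> v"
  shows "excess N X w - excess N X v \<le> excess L Y w - excess L Y v + \<epsilon> * (v - w)"
proof -
  interpret L: prob_space L by fact
  have [measurable]: "Y \<in> borel_measurable L" using L by auto
  have "ennreal (excess N X w - excess N X v)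
    = (\<integral>\<^sup>+t. ennreal \<P>(\<omega> in N. t < X \<omega>) * indicator {w..v} t \<partial>lborel)"
    by (rule prob_space.excess_diff) fact+
  also have "\<dots> \<le> (\<integral>\<^sup>+t. (ennreal \<P>(\<omega> in L. t < Y \<omega>) * indicator {w..v} t + ennreal \<epsilon> * indicator {w..v} t) \<partial>lborel)"
  proof (intro nn_integral_mono)
    fix t
    have "ennreal \<P>(\<omega> in N. t < X \<omega>) \<le> ennreal \<P>(\<omega> in L. t < Y \<omega>) + ennreal \<epsilon>"
      using tail[of t] \<open>0 \<le> \<epsilon>\<close> by (simp flip: ennreal_plus)
    then show "ennreal \<P>(\<omega> in N. t < X \<omega>) * indicator {w..v} t
      \<le> ennreal \<P>(\<omega> in L. t < Y \<omega>) * indicator {w..v} t + ennreal \<epsilon> * indicator {w..v} t"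
      by (auto simp: indicator_def)
  qed
  also have "\<dots> = (\<integral>\<^sup>+t. ennreal \<P>(\<omega> in L. t < Y \<omega>) * indicator {w..v} t \<partial>lborel) + ennreal \<epsilon> * ennreal (v - w)"
    using \<open>w \<le> v\<close> by (subst nn_integral_add) (auto simp: nn_integral_cmult_indicator)
  also have "\<dots> = ennreal (excess L Y w - excess L Y v) + ennreal (\<epsilon> * (v - w))"
    using \<open>w \<le> v\<close> \<open>0 \<le> \<epsilon>\<close> by (simp add: L.excess_diff[OF L(2)] ennreal_mult)
  also have "\<dots> = ennreal (excess L Y w - excess L Y v + \<epsilon> * (v - w))"
    using \<open>w \<le> v\<close> \<open>0 \<le> \<epsilon>\<close> L.excess_antimono[OF L(2) \<open>w \<le> v\<close>] by (simp add: ennreal_plus)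
  finally show ?thesis
    using \<open>w \<le> v\<close> \<open>0 \<le> \<epsilon>\<close> L.excess_antimono[OF L(2) \<open>w \<le> v\<close>] by (subst (asm) ennreal_le_iff) auto
qed

section \<open>CVaR bounds by choice of the minimisation variables\<close>

lemma (in prob_space) cvar_bdd_below:
  fixes X :: "'a \<Rightarrow> real"
  assumes "integrable M X" "0 < \<alpha>" "\<alpha> \<le> 1"
  shows "bdd_below (range (\<lambda>w. w + 1 / \<alpha> * excess M X w))"
proof (rule bdd_belowI2)
  fix w
  \<comment> \<open>The condition \<open>\<alpha> \<le> 1\<close> enters here: the excess then
    dominates the decrease of \<open>w\<close>, and the mean is a lower bound.\<close>
  have "1 * excess M X w \<le> 1 / \<alpha> * excess M X w"
    using assms by (intro mult_right_mono excess_nonneg) auto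
  then show "expectation X \<le> w + 1 / \<alpha> * excess M X w"
    using excess_ge_mean[OF assms(1), of w] by simp
qed

text \<open>The factor \<open>\<alpha>\<close> clears the denominator, so that objectives at the
  levels \<open>\<alpha>\<close>, \<open>\<epsilon>\<close> and their sum or difference combine
  linearly.\<close>

lemma (in prob_space) cvar_le:
  fixes X :: "'a \<Rightarrow> real"
  assumes "integrable M X" "0 < \<alpha>" "\<alpha> \<le> 1"
  shows "\<alpha> * cvar M \<alpha> X \<le> \<alpha> * w + excess M X w"
proof -
  have "cvar M \<alpha> X \<le> w + 1 / \<alpha> * excess M X w"
    unfolding cvar_def by (rule cINF_lower[OF cvar_bdd_below[OF assms]]) simp
  then have "\<alpha> * cvar M \<alpha> X \<le> \<alpha> * (w + 1 / \<alpha> * excess M X w)" using assms by (intro mult_left_mono) auto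
  then show ?thesis using assms by (simp add: algebra_simps)
qed

text \<open>
  The junk value of an infimum over a set unbounded below does no harm here, since the
  hypothesis provides a lower bound.
\<close>

lemma cvar_ge:
  assumes "0 < \<alpha>" "\<And>w. c \<le> \<alpha> * w + excess M X w"
  shows "c \<le> \<alpha> * cvar M \<alpha> X"
proof -
  have "c / \<alpha> \<le> w + 1 / \<alpha> * excess M X w" for w
    using assms(2)[of w] assms(1) by (simp add: field_simps)
  then have "c / \<alpha> \<le> cvar M \<alpha> X" unfolding cvar_def by (intro cINF_greatest) auto
  then show ?thesis using assms(1) by (simp add: field_simps)
qed

lemma cvar_le_bound:
  fixes X :: "'a \<Rightarrow> real"
  assumes "prob_space N" "integrable N X" "AE \<omega> in N. X \<omega> \<le> b" "0 < \<alpha>" "\<alpha> \<le> 1"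
  shows "cvar N \<alpha> X \<le> b"
proof -
  have "excess N X b = (\<integral>\<omega>. 0 \<partial>N)"
    using assms by (intro integral_cong_AE) (auto simp: max_def)
  then have "\<alpha> * cvar N \<alpha> X \<le> \<alpha> * b" using prob_space.cvar_le[OF assms(1,2,4,5), of b] by simp
  then show ?thesis using assms by simp
qed

text \<open>The excess of \<open>X\<close> vanishes at \<open>b\<close>. For
  \<open>w \<le> b\<close>, comparison on \<open>{w..b}\<close> costs
  \<open>\<epsilon> * (b - w)\<close>, which lowers the coefficient of \<open>w\<close> to
  \<open>\<alpha> - \<epsilon>\<close> and leaves \<open>\<epsilon> * b\<close>. For
  \<open>w > b\<close>, the test point \<open>b\<close> suffices.\<close>

lemma cvar_upper_bound:
  fixes X :: "'a \<Rightarrow> real" and Y :: "'b \<Rightarrow> real"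
  assumes N: "prob_space N" "integrable N X" and L: "prob_space L" "integrable L Y"
    and b: "AE \<omega> in N. X \<omega> \<le> b"
    and tail: "\<And>t. \<P>(\<omega> in N. t < X \<omega>) \<le> \<P>(\<omega> in L. t < Y \<omega>) + \<epsilon>"
    and \<epsilon>: "0 \<le> \<epsilon>" "\<epsilon> < \<alpha>" and \<alpha>: "\<alpha> \<le> 1"
  shows "cvar N \<alpha> X \<le> (1 - \<epsilon> / \<alpha>) * cvar L (\<alpha> - \<epsilon>) Y + \<epsilon> / \<alpha> * b"
proof -
  have "0 < \<alpha>" using \<epsilon> by simp
  interpret N: prob_space N by fact
  interpret L: prob_space L by fact
  have b0: "excess N X b = 0"
  proof -
    have "excess N X b = (\<integral>\<omega>. 0 \<partial>N)" using N b by (intro integral_cong_AE) (auto simp: max_def)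
    then show ?thesis by simp
  qed
  have "\<alpha> * cvar N \<alpha> X - \<epsilon> * b \<le> (\<alpha> - \<epsilon>) * cvar L (\<alpha> - \<epsilon>) Y"
  proof (rule cvar_ge)
    fix w
    show "\<alpha> * cvar N \<alpha> X - \<epsilon> * b \<le> (\<alpha> - \<epsilon>) * w + excess L Y w"
    proof (cases "w \<le> b")
      case True
      have "excess N X w \<le> excess L Y w + \<epsilon> * (b - w)"
        using excess_diff_le[OF N L tail \<epsilon>(1) True] b0 excess_nonneg[of L Y b] by linarith
      then show ?thesis using N.cvar_le[OF N(2) \<open>0 < \<alpha>\<close> \<alpha>, of w] by (simp add: algebra_simps)
    next
      case False
      have "(\<alpha> - \<epsilon>) * b \<le> (\<alpha> - \<epsilon>) * w" using False \<epsilon> by (intro mult_left_mono) auto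
      then show ?thesis
        using N.cvar_le[OF N(2) \<open>0 < \<alpha>\<close> \<alpha>, of b] b0 excess_nonneg[of L Y w] unfolding distrib_right distrib_left left_diff_distrib right_diff_distrib by linarith
    qed
  qed (use \<epsilon> in simp)
  then show ?thesis using \<open>0 < \<alpha>\<close> by (simp add: field_simps)
qed

text \<open>Let \<open>w\<close> and \<open>v\<close> be the variables of the infima at the levels
  \<open>\<alpha>\<close> and \<open>\<epsilon>\<close>. Testing the infimum at level
  \<open>\<alpha> + \<epsilon>\<close> with the smaller of the two gives the inequality for every
  such pair.\<close>

lemma cvar_lower_bound:
  fixes X :: "'a \<Rightarrow> real" and Y :: "'b \<Rightarrow> real"
  assumes N: "prob_space N" "integrable N X" and L: "prob_space L" "integrable L Y"
    and tail: "\<And>t. \<P>(\<omega> in L. t < Y \<omega>) \<le> \<P>(\<omega> in N. t < X \<omega>) + \<epsilon>"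
    and \<alpha>: "0 < \<alpha>" and \<epsilon>: "0 < \<epsilon>" "\<alpha> + \<epsilon> \<le> 1"
  shows "(1 + \<epsilon> / \<alpha>) * cvar L (\<alpha> + \<epsilon>) Y - \<epsilon> / \<alpha> * cvar L \<epsilon> Y \<le> cvar N \<alpha> X"
proof -
  interpret N: prob_space N by fact
  interpret L: prob_space L by fact
  let ?C = "(\<alpha> + \<epsilon>) * cvar L (\<alpha> + \<epsilon>) Y"
  have C: "?C \<le> (\<alpha> + \<epsilon>) * w + excess L Y w" for w
    using \<alpha> \<epsilon> by (intro L.cvar_le L) auto
  have "?C - \<alpha> * cvar N \<alpha> X \<le> \<epsilon> * cvar L \<epsilon> Y"
  proof (rule cvar_ge[OF \<epsilon>(1)])
    fix v
    have "?C - (\<epsilon> * v + excess L Y v) \<le> \<alpha> * cvar N \<alpha> X"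
    proof (rule cvar_ge[OF \<alpha>])
      fix w
      show "?C - (\<epsilon> * v + excess L Y v) \<le> \<alpha> * w + excess N X w"
      proof (cases "w \<le> v")
        case True
        have "excess L Y w - excess L Y v \<le> excess N X w + \<epsilon> * (v - w)"
          using excess_diff_le[OF L N tail less_imp_le[OF \<epsilon>(1)] True] excess_nonneg[of N X v] by linarith
        then show ?thesis using C[of w] by (simp add: algebra_simps)
      next
        case False
        then have "\<alpha> * v \<le> \<alpha> * w" using \<alpha> by simp
        then show ?thesis using C[of v] excess_nonneg[of N X w] unfolding distrib_right distrib_left left_diff_distrib right_diff_distrib by linarith
      qed
    qed
    then show "?C - \<alpha> * cvar N \<alpha> X \<le> \<epsilon> * v + excess L Y v" by simp
  qed
  then have "((\<alpha> + \<epsilon>) * cvar L (\<alpha> + \<epsilon>) Y - \<epsilon> * cvar L \<epsilon> Y) / \<alpha> \<le> cvar N \<alpha> X"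
    using \<alpha> by (simp add: field_simps)
  also have "((\<alpha> + \<epsilon>) * cvar L (\<alpha> + \<epsilon>) Y - \<epsilon> * cvar L \<epsilon> Y) / \<alpha>
    = (1 + \<epsilon> / \<alpha>) * cvar L (\<alpha> + \<epsilon>) Y - \<epsilon> / \<alpha> * cvar L \<epsilon> Y"
    using \<alpha> by (simp add: field_simps)
  finally show ?thesis .
qed

text \<open>For \<open>w \<ge> a\<close> the number \<open>?C\<close> is at most
  \<open>(\<alpha> + \<epsilon>) * w + excess L Y w\<close>, because the mean is at most
  \<open>w + excess L Y w\<close>. It thus replaces the CVaR at level
  \<open>\<alpha> + \<epsilon>\<close>, and the variables are played against each other as
  before.\<close>

lemma cvar_lower_bound_mean:
  fixes X :: "'a \<Rightarrow> real" and Y :: "'b \<Rightarrow> real"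
  assumes N: "prob_space N" "integrable N X" and L: "prob_space L" "integrable L Y"
    and a: "AE \<omega> in N. a \<le> X \<omega>"
    and tail: "\<And>t. \<P>(\<omega> in L. t < Y \<omega>) \<le> \<P>(\<omega> in N. t < X \<omega>) + \<epsilon>"
    and \<alpha>: "0 < \<alpha>" "\<alpha> \<le> 1" and \<epsilon>: "0 < \<epsilon>" "\<epsilon> \<le> 1" "1 \<le> \<alpha> + \<epsilon>"
  shows "1 / \<alpha> * ((\<alpha> + \<epsilon> - 1) * a + (\<integral>\<omega>. Y \<omega> \<partial>L) - \<epsilon> * cvar L \<epsilon> Y) \<le> cvar N \<alpha> X"
proof -
  interpret N: prob_space N by fact
  interpret L: prob_space L by fact
  let ?C = "(\<alpha> + \<epsilon> - 1) * a + (\<integral>\<omega>. Y \<omega> \<partial>L)"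
  have "?C - \<alpha> * cvar N \<alpha> X \<le> \<epsilon> * cvar L \<epsilon> Y"
  proof (rule cvar_ge[OF \<epsilon>(1)])
    fix v
    have ge: "?C - (\<epsilon> * v + excess L Y v) \<le> \<alpha> * w + excess N X w" if "a \<le> w" for w
    proof (cases "w \<le> v")
      case True
      have "excess L Y w - excess L Y v \<le> excess N X w + \<epsilon> * (v - w)"
        using excess_diff_le[OF L N tail less_imp_le[OF \<epsilon>(1)] True] excess_nonneg[of N X v] by linarith
      moreover have "(\<alpha> + \<epsilon> - 1) * a \<le> (\<alpha> + \<epsilon> - 1) * w"
        using that \<epsilon> by (intro mult_left_mono) auto
      ultimately show ?thesis using L.excess_ge_mean[OF L(2), of w] by (simp add: algebra_simps)
    next
      case False
      show ?thesis
      proof (cases "a \<le> v")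
        case True
        have "(\<alpha> + \<epsilon> - 1) * a \<le> (\<alpha> + \<epsilon> - 1) * v"
          using True \<epsilon> by (intro mult_left_mono) auto
        moreover have "\<alpha> * v \<le> \<alpha> * w" using \<alpha> False by simp
        ultimately show ?thesis
          using L.excess_ge_mean[OF L(2), of v] excess_nonneg[of N X w] unfolding distrib_right distrib_left left_diff_distrib right_diff_distrib by linarith
      next
        case False
        \<comment> \<open>Here \<open>v < a \<le> w\<close>: the mean is bounded through
          \<open>v\<close>, and \<open>\<epsilon> \<le> 1\<close> allows \<open>v\<close> to be
          raised to \<open>a\<close>.\<close>
        have "(1 - \<epsilon>) * v \<le> (1 - \<epsilon>) * a" using False \<epsilon> by (intro mult_left_mono) auto
        moreover have "\<alpha> * a \<le> \<alpha> * w" using \<alpha> that by simp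
        ultimately show ?thesis
          using L.excess_ge_mean[OF L(2), of v] excess_nonneg[of N X w] unfolding distrib_right distrib_left left_diff_distrib right_diff_distrib by linarith
      qed
    qed
    have "?C - (\<epsilon> * v + excess L Y v) \<le> \<alpha> * cvar N \<alpha> X"
    proof (rule cvar_ge[OF \<alpha>(1)])
      fix w
      show "?C - (\<epsilon> * v + excess L Y v) \<le> \<alpha> * w + excess N X w"
      proof (cases "a \<le> w")
        case False
        \<comment> \<open>Moving \<open>w\<close> up to \<open>a\<close> lowers the excess of
          \<open>X\<close> by at least \<open>a - w\<close>, while \<open>\<alpha> * w\<close> grows
          by no more than that as \<open>\<alpha> \<le> 1\<close>.\<close>
        have "excess N X a + (a - w) = (\<integral>\<omega>. max (X \<omega> - a) 0 + (a - w) \<partial>N)"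
          using N by (subst Bochner_Integration.integral_add) (auto simp: N.prob_space)
        also have "\<dots> \<le> excess N X w"
        proof (rule integral_mono_AE)
          show "AE \<omega> in N. max (X \<omega> - a) 0 + (a - w) \<le> max (X \<omega> - w) 0"
            using a by eventually_elim (use False in auto)
        qed (use N in simp_all)
        finally have "excess N X a + (a - w) \<le> excess N X w" .
        moreover have "\<alpha> * (a - w) \<le> 1 * (a - w)" using False \<alpha> by (intro mult_right_mono) auto
        ultimately show ?thesis using ge[of a] by (simp add: algebra_simps)
      qed (rule ge)
    qed
    then show "?C - \<alpha> * cvar N \<alpha> X \<le> \<epsilon> * v + excess L Y v" by simp
  qed
  then show ?thesis using \<alpha> by (simp add: field_simps)
qed

text \<open>The objective is continuous in \<open>w\<close>, so its infimum is already attained as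
  an infimum over the rationals, which is countable. Measurability is needed for the final events to
  be bounded below in probability.\<close>

lemma emp_cvar_measurable:
  fixes Xs :: "nat \<Rightarrow> 'b \<Rightarrow> real"
  assumes Xs[measurable]: "\<And>i. i \<in> {1..n} \<Longrightarrow> Xs i \<in> borel_measurable M"
    and "1 \<le> n" "0 < \<beta>" "\<beta> \<le> 1"
  shows "(\<lambda>\<omega>. emp_cvar n (\<lambda>i. Xs i \<omega>) \<beta>) \<in> borel_measurable M"
proof -
  define g where "g w \<omega> = w + 1 / (real n * \<beta>) * (\<Sum>i = 1..n. max (Xs i \<omega> - w) 0)" for w \<omega>
  have bdd: "bdd_below (range (\<lambda>w. g w \<omega>))" for \<omega>
  proof -
    have "integrable (measure_pmf (emp_distr n (\<lambda>i. Xs i \<omega>))) (\<lambda>t. t)"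
      using \<open>1 \<le> n\<close> by (intro integrable_measure_pmf_finite) (simp add: emp_distr_def)
    from measure_pmf.cvar_bdd_below[OF this assms(3,4)] show ?thesis
      by (simp add: expectation_emp_distr[OF \<open>1 \<le> n\<close>] g_def mult.commute)
  qed
  have "emp_cvar n (\<lambda>i. Xs i \<omega>) \<beta> = (INF w\<in>\<rat>. g w \<omega>)" for \<omega>
  proof (rule antisym)
    show "emp_cvar n (\<lambda>i. Xs i \<omega>) \<beta> \<le> (INF w\<in>\<rat>. g w \<omega>)"
      unfolding emp_cvar_def g_def[symmetric] using bdd[of \<omega>]
      by (intro cINF_superset_mono) auto
    have "(INF w\<in>\<rat>. g w \<omega>) \<le> g w \<omega>" for w
    proof -
      have "w \<in> closure \<rat>" by (simp add: Rats_closure_real)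
      then obtain r where r: "\<And>k. r k \<in> \<rat>" "r \<longlonglongrightarrow> w" by (auto simp: closure_sequential)
      have "(\<lambda>k. g (r k) \<omega>) \<longlonglongrightarrow> g w \<omega>" unfolding g_def by (intro tendsto_intros r)
      moreover have "(INF w\<in>\<rat>. g w \<omega>) \<le> g (r k) \<omega>" for k
        using bdd[of \<omega>] r by (intro cINF_lower) (auto intro: bdd_below_mono)
      ultimately show ?thesis by (intro LIMSEQ_le_const) auto
    qed
    then show "(INF w\<in>\<rat>. g w \<omega>) \<le> emp_cvar n (\<lambda>i. Xs i \<omega>) \<beta>"
      unfolding emp_cvar_def g_def[symmetric] by (intro cINF_greatest) auto
  qed
  moreover have "(\<lambda>\<omega>. INF w\<in>\<rat>. g w \<omega>) \<in> borel_measurable M"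
    by (intro borel_measurable_cINF_real countable_rat) (simp add: g_def)
  ultimately show ?thesis by simp
qed

section \<open>From sample counts to tails of the empirical distribution\<close>

lemma prob_emp_distr:
  assumes "1 \<le> n"
  shows "\<P>(y in measure_pmf (emp_distr n x). P y) = real (card {i\<in>{1..n}. P (x i)}) / real n"
  using assms by (simp add: emp_distr_def measure_pmf_of_set Int_def vimage_def conj_commute)

text \<open>Counts are controlled at rational points only. For \<open>t < r < s\<close> with
  \<open>r\<close> rational, monotonicity gives the bound with the CDF at \<open>s\<close>; letting
  \<open>s\<close> decrease to \<open>t\<close>, right continuity gives it at
  \<open>t\<close>.\<close>

lemma tail_le_of_dkw:
  fixes X :: "'a \<Rightarrow> real"
  assumes N: "prob_space N" and X[measurable]: "X \<in> borel_measurable N" and n: "1 \<le> n"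
    and le: "\<And>t. t \<in> \<rat> \<Longrightarrow> real (card {i\<in>{1..n}. x i \<le> t}) \<le> real n * (\<P>(\<omega> in N. X \<omega> \<le> t) + \<epsilon>)"
  shows "\<P>(\<omega> in N. t < X \<omega>) \<le> \<P>(y in measure_pmf (emp_distr n x). t < y) + \<epsilon>"
proof -
  interpret N: prob_space N by fact
  interpret D: real_distribution "distr N borel X" by (rule N.real_distribution_distr) simp
  have cdf: "cdf (distr N borel X) s = \<P>(\<omega> in N. X \<omega> \<le> s)" for s
    by (simp add: cdf_def measure_distr vimage_def Int_def conj_commute)
  have "real (card {i\<in>{1..n}. x i \<le> t}) / real n - \<epsilon> \<le> cdf (distr N borel X) t"
  proof (rule tendsto_lowerbound)
    show "(cdf (distr N borel X) \<longlongrightarrow> cdf (distr N borel X) t) (at_right t)"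
      using D.cdf_is_right_cont[of t] by (simp add: continuous_within)
    show "\<forall>\<^sub>F s in at_right t. real (card {i\<in>{1..n}. x i \<le> t}) / real n - \<epsilon> \<le> cdf (distr N borel X) s"
      using eventually_at_right_less[of t]
    proof eventually_elim
      fix s assume "t < s"
      then obtain r where r: "r \<in> \<rat>" "t < r" "r < s" using Rats_dense_in_real by blast
      have "card {i\<in>{1..n}. x i \<le> t} \<le> card {i\<in>{1..n}. x i \<le> r}"
        using r by (intro card_mono) auto
      with le[OF r(1)] have "real (card {i\<in>{1..n}. x i \<le> t}) \<le> real n * (cdf (distr N borel X) r + \<epsilon>)"
        by (simp add: cdf)
      then have "real (card {i\<in>{1..n}. x i \<le> t}) / real n - \<epsilon> \<le> cdf (distr N borel X) r"
        using n by (simp add: field_simps)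
      also have "\<dots> \<le> cdf (distr N borel X) s" using r by (intro D.cdf_nondecreasing) simp
      finally show "real (card {i\<in>{1..n}. x i \<le> t}) / real n - \<epsilon> \<le> cdf (distr N borel X) s" .
    qed
  qed simp
  moreover have "\<P>(\<omega> in N. t < X \<omega>) = 1 - \<P>(\<omega> in N. X \<omega> \<le> t)"
    using N.prob_neg[of "\<lambda>\<omega>. X \<omega> \<le> t"] by (simp add: not_le)
  moreover have "\<P>(y in measure_pmf (emp_distr n x). t < y) = 1 - real (card {i\<in>{1..n}. x i \<le> t}) / real n"
    using measure_pmf.prob_neg[where M = "emp_distr n x" and P = "\<lambda>y. y \<le> t"] prob_emp_distr[OF n, of x "\<lambda>y. y \<le> t"]
    by (simp add: not_le)
  ultimately show ?thesis by (simp add: cdf)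
qed

text \<open>The sample is finite, so a rational \<open>r\<close> fits strictly between
  \<open>t\<close> and the smallest sample point above \<open>t\<close>. The hypothesis at
  \<open>- r\<close> bounds the count through \<open>X \<ge> r\<close>, an event contained in
  \<open>X > t\<close>.\<close>

lemma emp_tail_le_of_dkw:
  fixes X :: "'a \<Rightarrow> real"
  assumes N: "prob_space N" and X[measurable]: "X \<in> borel_measurable N" and n: "1 \<le> n" and \<epsilon>: "0 \<le> \<epsilon>"
    and le: "\<And>t. t \<in> \<rat> \<Longrightarrow> real (card {i\<in>{1..n}. - x i \<le> t}) \<le> real n * (\<P>(\<omega> in N. - X \<omega> \<le> t) + \<epsilon>)"
  shows "\<P>(y in measure_pmf (emp_distr n x). t < y) \<le> \<P>(\<omega> in N. t < X \<omega>) + \<epsilon>"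
proof -
  interpret N: prob_space N by fact
  let ?I = "{i\<in>{1..n}. t < x i}"
  have "real (card ?I) \<le> real n * (\<P>(\<omega> in N. t < X \<omega>) + \<epsilon>)"
  proof (cases "?I = {}")
    case True
    then show ?thesis using \<epsilon> by (simp only: card.empty) simp
  next
    case False
    have "Min (x ` ?I) \<in> x ` ?I" using False by (intro Min_in) auto
    then have "t < Min (x ` ?I)" by auto
    then obtain r where r: "r \<in> \<rat>" "t < r" "r < Min (x ` ?I)" using Rats_dense_in_real by blast
    have "r \<le> x i" if "i \<in> ?I" for i
    proof -
      have "Min (x ` ?I) \<le> x i" using that by (intro Min_le) auto
      with r show ?thesis by simp
    qed
    then have "card ?I \<le> card {i\<in>{1..n}. - x i \<le> - r}" by (intro card_mono) auto
    then have "real (card ?I) \<le> real n * (\<P>(\<omega> in N. - X \<omega> \<le> - r) + \<epsilon>)"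
      using le[of "- r"] r(1) by simp
    also have "\<dots> \<le> real n * (\<P>(\<omega> in N. t < X \<omega>) + \<epsilon>)"
      using r by (intro mult_left_mono add_right_mono N.finite_measure_mono) auto
    finally show ?thesis .
  qed
  then show ?thesis unfolding prob_emp_distr[OF n] using n by (simp add: field_simps)
qed

section \<open>Confidence bounds outside a deviation event\<close>

lemma (in prob_space) prob_gt_of_compl_subset:
  assumes "A \<in> events" "prob A < \<delta>" "{\<omega>\<in>space M. P \<omega>} \<in> events"
    and "\<And>\<omega>. \<omega> \<in> space M \<Longrightarrow> \<omega> \<notin> A \<Longrightarrow> P \<omega>"
  shows "1 - \<delta> < \<P>(\<omega> in M. P \<omega>)"
proof -
  have "1 - \<delta> < prob (space M - A)" using assms by (simp add: prob_compl)
  also have "\<dots> \<le> \<P>(\<omega> in M. P \<omega>)" using assms by (intro finite_measure_mono) auto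
  finally show ?thesis .
qed

theorem theorem3p8:
  fixes N :: "'a measure" and X :: "'a \<Rightarrow> real"
    and M :: "'b measure" and Xs :: "nat \<Rightarrow> 'b \<Rightarrow> real"
    and \<alpha> \<delta> \<epsilon> :: real and n :: nat
  assumes "prob_space N" and "integrable N X"
    and "0 < \<alpha>" and "\<alpha> \<le> 1" and "0 < \<delta>" and "\<delta> < 1" and "1 \<le> n"
    and "\<epsilon> = sqrt (ln (1 / \<delta>) / (2 * real n))"
    and "prob_space M"
    and "prob_space.indep_vars M (\<lambda>_. borel) Xs {1..n}"
    and "\<And>i. i \<in> {1..n} \<Longrightarrow> cdf (distr M borel (Xs i)) = cdf (distr N borel X)"
  shows "(\<forall>b. \<P>(\<omega> in N. X \<omega> \<le> b) = 1 \<longrightarrow>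
      (\<epsilon> < \<alpha> \<longrightarrow>
        \<P>(\<omega> in M. cvar N \<alpha> X \<le>
          (1 - \<epsilon> / \<alpha>) * emp_cvar n (\<lambda>i. Xs i \<omega>) (\<alpha> - \<epsilon>) + \<epsilon> / \<alpha> * b) > 1 - \<delta>) \<and>
      (\<alpha> \<le> \<epsilon> \<longrightarrow> cvar N \<alpha> X \<le> b)) \<and>
    (\<forall>a. \<P>(\<omega> in N. X \<omega> \<ge> a) = 1 \<longrightarrow>
      (\<alpha> + \<epsilon> < 1 \<longrightarrow>
        \<P>(\<omega> in M. cvar N \<alpha> X \<ge>
          (1 + \<epsilon> / \<alpha>) * emp_cvar n (\<lambda>i. Xs i \<omega>) (\<alpha> + \<epsilon>)
            - \<epsilon> / \<alpha> * emp_cvar n (\<lambda>i. Xs i \<omega>) \<epsilon>) > 1 - \<delta>) \<and>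
      (1 \<le> \<alpha> + \<epsilon> \<and> \<epsilon> \<le> 1 \<longrightarrow>
        \<P>(\<omega> in M. cvar N \<alpha> X \<ge>
          1 / \<alpha> * ((\<alpha> + \<epsilon> - 1) * a + emp_mean n (\<lambda>i. Xs i \<omega>)
            - \<epsilon> * emp_cvar n (\<lambda>i. Xs i \<omega>) \<epsilon>)) > 1 - \<delta>))"
proof -
  note N = assms(1,2) and \<alpha> = assms(3,4) and \<delta> = assms(5,6) and n = assms(7)
    and M = assms(9) and indep = assms(10)
  interpret N: prob_space N by fact
  interpret M: prob_space M by fact
  have X[measurable]: "X \<in> borel_measurable N" using N by auto
  have Xs[measurable]: "Xs i \<in> borel_measurable M" if "i \<in> {1..n}" for i
    using indep that by (auto simp: M.indep_vars_def)
  have law: "distr M borel (Xs i) = distr N borel X" if "i \<in> {1..n}" for i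
    using that assms(11) by (intro cdf_unique M.real_distribution_distr N.real_distribution_distr) auto
  have "0 < ln (1 / \<delta>)" using \<delta> by (simp add: ln_div)
  then have sq: "\<epsilon>^2 = ln (1 / \<delta>) / (2 * real n)" and \<epsilon>: "0 < \<epsilon>" using n by (simp_all add: assms(8))
  \<comment> \<open>The radius \<open>\<epsilon>\<close> is chosen so that the deviation bound is
    exactly \<open>\<delta>\<close>.\<close>
  have "- 2 * real n * \<epsilon>^2 = ln \<delta>" using n \<delta> by (simp add: sq ln_div)
  then have exp_\<delta>: "exp (- 2 * real n * \<epsilon>^2) = \<delta>" using \<delta> by simp
  \<comment> \<open>For each outcome the comparison lemmas are applied to the empirical distribution
    with the identity as random variable.\<close>
  let ?L = "\<lambda>\<omega>. measure_pmf (emp_distr n (\<lambda>i. Xs i \<omega>))"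
  have L: "prob_space (?L \<omega>)" "integrable (?L \<omega>) (\<lambda>t. t)" for \<omega>
    using n by (auto intro!: measure_pmf.prob_space_axioms integrable_measure_pmf_finite simp: emp_distr_def)
  note emp = cvar_emp_distr[OF n] mean_emp_distr[OF n]
  \<comment> \<open>Outside \<open>?A\<close> the true tails exceed the empirical ones by at most
    \<open>\<epsilon>\<close>, outside \<open>?B\<close> conversely. Each part uses one of the two
    events, so \<open>\<delta>\<close> is not split.\<close>
  let ?A = "{\<omega>\<in>space M. \<exists>t\<in>\<rat>. real n * (\<P>(x in N. X x \<le> t) + \<epsilon>) < real (card {i\<in>{1..n}. Xs i \<omega> \<le> t})}"
  let ?B = "{\<omega>\<in>space M. \<exists>t\<in>\<rat>. real n * (\<P>(x in N. - X x \<le> t) + \<epsilon>) < real (card {i\<in>{1..n}. - Xs i \<omega> \<le> t})}"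
  have A: "?A \<in> M.events" "M.prob ?A < \<delta>"
    using dkw_one_sided[OF N(1) X M indep law n \<epsilon>] unfolding exp_\<delta> by blast+
  have B: "?B \<in> M.events" "M.prob ?B < \<delta>"
  proof -
    have indep': "M.indep_vars (\<lambda>_. borel) (\<lambda>i \<omega>. - Xs i \<omega>) {1..n}"
      using M.indep_vars_compose2[OF indep, of "\<lambda>_. uminus" "\<lambda>_. borel"] by simp
    have law': "distr M borel (\<lambda>\<omega>. - Xs i \<omega>) = distr N borel (\<lambda>x. - X x)" if "i \<in> {1..n}" for i
    proof -
      have "distr M borel (\<lambda>\<omega>. - Xs i \<omega>) = distr (distr M borel (Xs i)) borel uminus"
        using that by (subst distr_distr) (auto simp: comp_def)
      also have "\<dots> = distr N borel (\<lambda>x. - X x)"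
        unfolding law[OF that] by (subst distr_distr) (auto simp: comp_def)
      finally show ?thesis .
    qed
    have X': "(\<lambda>x. - X x) \<in> borel_measurable N" by simp
    show "?B \<in> M.events" "M.prob ?B < \<delta>"
      using dkw_one_sided[OF N(1) X' M indep' law' n \<epsilon>] unfolding exp_\<delta> by blast+
  qed
  have upper_tail: "\<P>(x in N. t < X x) \<le> \<P>(y in ?L \<omega>. t < y) + \<epsilon>" if "\<omega> \<in> space M" "\<omega> \<notin> ?A" for \<omega> t
    using that by (intro tail_le_of_dkw[OF N(1) X n]) (auto simp: not_less)
  have lower_tail: "\<P>(y in ?L \<omega>. t < y) \<le> \<P>(x in N. t < X x) + \<epsilon>" if "\<omega> \<in> space M" "\<omega> \<notin> ?B" for \<omega> t
    using that \<epsilon> by (intro emp_tail_le_of_dkw[OF N(1) X n]) (auto simp: not_less)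
  have [measurable]: "(\<lambda>\<omega>. emp_mean n (\<lambda>i. Xs i \<omega>)) \<in> borel_measurable M"
    unfolding emp_mean_def by measurable
  show ?thesis
  proof (intro conjI allI impI)
    fix b assume "\<P>(\<omega> in N. X \<omega> \<le> b) = 1"
    then have b: "AE \<omega> in N. X \<omega> \<le> b" by (subst (asm) N.prob_Collect_eq_1) auto
    show "cvar N \<alpha> X \<le> b" by (rule cvar_le_bound[OF N b \<alpha>])
    assume less: "\<epsilon> < \<alpha>"
    have [measurable]: "(\<lambda>\<omega>. emp_cvar n (\<lambda>i. Xs i \<omega>) (\<alpha> - \<epsilon>)) \<in> borel_measurable M"
      using less \<alpha> \<epsilon> n by (intro emp_cvar_measurable) auto
    show "1 - \<delta> < \<P>(\<omega> in M. cvar N \<alpha> X \<le>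
      (1 - \<epsilon> / \<alpha>) * emp_cvar n (\<lambda>i. Xs i \<omega>) (\<alpha> - \<epsilon>) + \<epsilon> / \<alpha> * b)"
    proof (rule M.prob_gt_of_compl_subset[OF A])
      fix \<omega> assume "\<omega> \<in> space M" "\<omega> \<notin> ?A"
      from cvar_upper_bound[OF N L b upper_tail[OF this] _ less \<alpha>(2)] \<epsilon>
      show "cvar N \<alpha> X \<le> (1 - \<epsilon> / \<alpha>) * emp_cvar n (\<lambda>i. Xs i \<omega>) (\<alpha> - \<epsilon>) + \<epsilon> / \<alpha> * b"
        by (simp add: emp)
    qed measurable
  next
    fix a assume "\<P>(\<omega> in N. a \<le> X \<omega>) = 1"
    then have a: "AE \<omega> in N. a \<le> X \<omega>" by (subst (asm) N.prob_Collect_eq_1) auto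
    {
      assume sum: "\<alpha> + \<epsilon> < 1"
      have [measurable]: "(\<lambda>\<omega>. emp_cvar n (\<lambda>i. Xs i \<omega>) (\<alpha> + \<epsilon>)) \<in> borel_measurable M"
        "(\<lambda>\<omega>. emp_cvar n (\<lambda>i. Xs i \<omega>) \<epsilon>) \<in> borel_measurable M"
        using sum \<alpha> \<epsilon> n by (auto intro!: emp_cvar_measurable)
      show "1 - \<delta> < \<P>(\<omega> in M. (1 + \<epsilon> / \<alpha>) * emp_cvar n (\<lambda>i. Xs i \<omega>) (\<alpha> + \<epsilon>)
        - \<epsilon> / \<alpha> * emp_cvar n (\<lambda>i. Xs i \<omega>) \<epsilon> \<le> cvar N \<alpha> X)"
      proof (rule M.prob_gt_of_compl_subset[OF B])
        fix \<omega> assume "\<omega> \<in> space M" "\<omega> \<notin> ?B"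
        from cvar_lower_bound[OF N L lower_tail[OF this] \<alpha>(1) \<epsilon>] sum
        show "(1 + \<epsilon> / \<alpha>) * emp_cvar n (\<lambda>i. Xs i \<omega>) (\<alpha> + \<epsilon>)
          - \<epsilon> / \<alpha> * emp_cvar n (\<lambda>i. Xs i \<omega>) \<epsilon> \<le> cvar N \<alpha> X"
          by (simp add: emp)
      qed measurable
    next
      assume sum: "1 \<le> \<alpha> + \<epsilon> \<and> \<epsilon> \<le> 1"
      have [measurable]: "(\<lambda>\<omega>. emp_cvar n (\<lambda>i. Xs i \<omega>) \<epsilon>) \<in> borel_measurable M"
        using sum \<epsilon> n by (auto intro!: emp_cvar_measurable)
      show "1 - \<delta> < \<P>(\<omega> in M. 1 / \<alpha> * ((\<alpha> + \<epsilon> - 1) * a + emp_mean n (\<lambda>i. Xs i \<omega>)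
        - \<epsilon> * emp_cvar n (\<lambda>i. Xs i \<omega>) \<epsilon>) \<le> cvar N \<alpha> X)"
      proof (rule M.prob_gt_of_compl_subset[OF B])
        fix \<omega> assume "\<omega> \<in> space M" "\<omega> \<notin> ?B"
        from cvar_lower_bound_mean[OF N L a lower_tail[OF this] \<alpha> \<epsilon>] sum
        show "1 / \<alpha> * ((\<alpha> + \<epsilon> - 1) * a + emp_mean n (\<lambda>i. Xs i \<omega>)
          - \<epsilon> * emp_cvar n (\<lambda>i. Xs i \<omega>) \<epsilon>) \<le> cvar N \<alpha> X"
          by (simp add: emp)
      qed measurable
    }
  qed
qed

end
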